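(* Let $p \colon E \to B$ be a fibration, where $E$ and $E \times_B E$ are ANRs. Then $$\mathrm{TC}^{M}[p \colon E\to B] = \mathrm{TC}_g^{M}[p \colon E\to B] = \mathrm{TC}^{DM}[p \colon E\to B].$$
   Context: Fibration means Hurewicz fibration, $I=[0,1]$; ANR means absolute neighborhood retract for metrizable spaces (in particular metrizable). For a fibration $p \colon E \to B$: $E \times_B E = \{(e_1,e_2)\in E\times E \mid p(e_1)=p(e_2)\}$ with diagonal $\Delta E = \{(e,e)\mid e\in E\}$; $E^I_B = \{\gamma \in E^I \mid p\circ\gamma \text{ is constant}\}$ (subspace of $E^I$ with compact-open topology); $\Pi \colon E^I_B \to E \times_B E$, $\Pi(\gamma) = (\gamma(0),\gamma(1))$, which is a fibration; $\mathrm{c}_e$ is the constant path at $e$. Sections are continuous; each invariant is $\infty$ if no such integer exists. $\mathrm{TC}^{M}[p \colon E\to B]$ (monoidal parametrized topological complexity) is the least nonnegative integer $k$ such that $E \times_B E$ may be covered by open subsets $U_0,\dots,U_k$, each containing $\Delta E$ and admitting a section $\sigma_i \colon U_i \to E^I_B$ of $\Pi$ with $\sigma_i(e,e) = \mathrm{c}_e$ for all $e \in E$. $\mathrm{TC}_g^{M}[p \colon E\to B]$ is defined in the same way except that the covering sets are not required to be open. $\mathrm{TC}^{DM}[p \colon E\to B]$ (D-monoidal) is the least nonnegative integer $k$ such that $E \times_B E$ may be covered by open subsets $U_0,\dots,U_k$, each admitting a section $\sigma_i \colon U_i \to E^I_B$ of $\Pi$ with $\sigma_i(e,e) = \mathrm{c}_e$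 for all $e \in E$ with $(e,e) \in U_i$. *)

theory Defs
  imports "HOL-Analysis.Analysis" "HOL-Library.Extended_Nat"
begin

abbreviation unit_interval :: "real topology"
  where "unit_interval \<equiv> top_of_set {0..1}"

text \<open>The set \<open>Y\<^sup>X\<close> of continuous maps with the compact-open topology. Maps are taken to be
  \<open>undefined\<close> off the carrier of \<open>X\<close>, so that equality of HOL functions is equality of maps.
  (The subbasic sets cover everything, since \<open>K\<close> may be empty.)\<close>

definition compact_open_topology :: "'a topology \<Rightarrow> 'b topology \<Rightarrow> ('a \<Rightarrow> 'b) topology"
  where "compact_open_topology X Y =
    subtopology
      (topology_generated_by {{f. f ` K \<subseteq> V} | K V. compactin X K \<and> openin Y V})
      {f \<in> extensional (topspace X). continuous_map X Y f}"

lemma topspace_compact_open_topology: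
  "topspace (compact_open_topology X Y) =
    {f \<in> extensional (topspace X). continuous_map X Y f}"
proof -
  have "f \<in> \<Union>{{f. f ` K \<subseteq> V} | K V. compactin X K \<and> openin Y V}" for f
    using compactin_empty[of X] openin_empty[of Y] by blast
  then show ?thesis
    unfolding compact_open_topology_def topspace_subtopology topology_generated_by_topspace
    by blast
qed

definition homotopy_lifting_property ::
    "'x topology \<Rightarrow> 'a topology \<Rightarrow> 'b topology \<Rightarrow> ('a \<Rightarrow> 'b) \<Rightarrow> bool"
  where "homotopy_lifting_property X E B p \<longleftrightarrow>
    (\<forall>f H. continuous_map X E f \<and>
           continuous_map (prod_topology X unit_interval) B H \<and>
           (\<forall>x\<in>topspace X. H (x, 0) = p (f x)) \<longrightarrow>
       (\<exists>G. continuous_map (prod_topology X unit_interval) E G \<and>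
            (\<forall>x\<in>topspace X. G (x, 0) = f x) \<and>
            (\<forall>x\<in>topspace X. \<forall>t\<in>{0..1}. p (G (x, t)) = H (x, t))))"

text \<open>HOL cannot quantify over types inside a formula, so the test spaces \<open>X\<close> range over all
  topological spaces carried by a subset of \<open>'a \<times> (real \<Rightarrow> 'b)\<close>. This is no restriction:
  among them is the mapping path space \<open>{(e, \<beta>). p e = \<beta> 0}\<close>, a subspace of \<open>E \<times> B\<^sup>I\<close>. A solution
  of its universal lifting problem is a lifting function for \<open>p\<close> and yields lifts for test
  spaces of every type.\<close>

definition hurewicz_fibration :: "'a topology \<Rightarrow> 'b topology \<Rightarrow> ('a \<Rightarrow> 'b) \<Rightarrow> bool"
  where "hurewicz_fibration E B p \<longleftrightarrow>
    continuous_map E B p \<and>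
    (\<forall>X :: ('a \<times> (real \<Rightarrow> 'b)) topology. homotopy_lifting_property X E B p)"

text \<open>Absolute neighbourhood retracts for the class of all metrizable spaces (the library's
  \<open>ANR\<close> only treats subsets of Euclidean spaces). The ambient spaces \<open>Y\<close> range over all metrizable
  spaces carried by a subset of \<open>'a \<Rightarrow> real\<close>. This is again no restriction: for a bounded metric on
  \<open>X\<close>, the Kuratowski-Wojdyslawski embedding realises \<open>X\<close> as a closed subset of its
  convex hull in the bounded functions on \<open>X\<close> with the sup metric, and by Dugundji's extension
  theorem a neighbourhood retract of that convex set is a neighbourhood retract of every metrizable
  space containing it as a closed subset.\<close>

definition ANR_space :: "'a topology \<Rightarrow> bool"
  where "ANR_space X \<longleftrightarrow>
    metrizable_space X \<and>
    (\<forall>(Y :: ('a \<Rightarrow> real) topology) h.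
       metrizable_space Y \<and> embedding_map X Y h \<and> closedin Y (h ` topspace X) \<longrightarrow>
       (\<exists>U. openin Y U \<and> (h ` topspace X) retract_of_space (subtopology Y U)))"

definition fibre_product :: "'a topology \<Rightarrow> ('a \<Rightarrow> 'b) \<Rightarrow> ('a \<times> 'a) topology"
  where "fibre_product E p = subtopology (prod_topology E E) {(e1, e2). p e1 = p e2}"

definition diagonal :: "'a topology \<Rightarrow> ('a \<times> 'a) set"
  where "diagonal E = (\<lambda>e. (e, e)) ` topspace E"

definition fibrewise_path_space :: "'a topology \<Rightarrow> ('a \<Rightarrow> 'b) \<Rightarrow> (real \<Rightarrow> 'a) topology"
  where "fibrewise_path_space E p =
    subtopology (compact_open_topology unit_interval E)
      {\<gamma>. \<exists>b. \<forall>t\<in>{0..1}. p (\<gamma> t) = b}"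

definition endpoints :: "(real \<Rightarrow> 'a) \<Rightarrow> 'a \<times> 'a"
  where "endpoints \<gamma> = (\<gamma> 0, \<gamma> 1)"

definition const_path :: "'a \<Rightarrow> real \<Rightarrow> 'a"
  where "const_path e = (\<lambda>t\<in>{0..1}. e)"

text \<open>\<open>\<sigma>\<close> is a continuous section over \<open>U\<close> of \<open>endpoints\<close>, taking diagonal points of \<open>U\<close> to
  constant paths. If \<open>U\<close> contains the whole diagonal, the last clause is the condition for all
  points of \<open>E\<close>.\<close>

definition reserved_section ::
    "'a topology \<Rightarrow> ('a \<Rightarrow> 'b) \<Rightarrow> ('a \<times> 'a) set \<Rightarrow> ('a \<times> 'a \<Rightarrow> real \<Rightarrow> 'a) \<Rightarrow> bool"
  where "reserved_section E p U \<sigma> \<longleftrightarrow>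
    continuous_map (subtopology (fibre_product E p) U) (fibrewise_path_space E p) \<sigma> \<and>
    (\<forall>z\<in>U. endpoints (\<sigma> z) = z) \<and>
    (\<forall>e\<in>topspace E. (e, e) \<in> U \<longrightarrow> \<sigma> (e, e) = const_path e)"

text \<open>In each of the following, the infimum over the empty set is \<open>\<infinity>\<close>.\<close>

definition TC_M :: "'a topology \<Rightarrow> ('a \<Rightarrow> 'b) \<Rightarrow> enat"
  where "TC_M E p = Inf {enat k | k. \<exists>U :: nat \<Rightarrow> ('a \<times> 'a) set.
    (\<Union>i\<le>k. U i) = topspace (fibre_product E p) \<and>
    (\<forall>i\<le>k. openin (fibre_product E p) (U i) \<and> diagonal E \<subseteq> U i \<and>
      (\<exists>\<sigma>. reserved_section E p (U i) \<sigma>))}"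

definition TC_gM :: "'a topology \<Rightarrow> ('a \<Rightarrow> 'b) \<Rightarrow> enat"
  where "TC_gM E p = Inf {enat k | k. \<exists>U :: nat \<Rightarrow> ('a \<times> 'a) set.
    (\<Union>i\<le>k. U i) = topspace (fibre_product E p) \<and>
    (\<forall>i\<le>k. diagonal E \<subseteq> U i \<and> (\<exists>\<sigma>. reserved_section E p (U i) \<sigma>))}"

definition TC_DM :: "'a topology \<Rightarrow> ('a \<Rightarrow> 'b) \<Rightarrow> enat"
  where "TC_DM E p = Inf {enat k | k. \<exists>U :: nat \<Rightarrow> ('a \<times> 'a) set.
    (\<Union>i\<le>k. U i) = topspace (fibre_product E p) \<and>
    (\<forall>i\<le>k. openin (fibre_product E p) (U i) \<and>
      (\<exists>\<sigma>. reserved_section E p (U i) \<sigma>))}"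

end

theory Submission
  imports Defs "HOL-Probability.Discrete_Topology"
begin

text \<open>Everything reduces to two constructions on \<open>Z = E \<times>\<^sub>B E\<close>. An open cover with reserved sections shrinks
  to a closed one, and over a closed set the section can be glued with the constant paths over the
  diagonal. Conversely, a reserved section over an arbitrary set \<open>U\<close> containing the diagonal is a
  deformation of \<open>U\<close> in \<open>Z\<close> into the diagonal, relative to the diagonal. Embed \<open>Z\<close> in a space of bounded
  functions, approximate the deformation by a continuous family defined near \<open>U\<close>, damp it to the
  identity near the diagonal, and push it back into \<open>Z\<close> by a neighbourhood retraction; the error at
  both ends is absorbed by straight-line homotopies and by a deformation of a neighbourhood of the
  diagonal, so that an open \<open>V \<supseteq> U\<close> deforms into the diagonal. A deformation \<open>(\<Gamma>\<^sub>1, \<Gamma>\<^sub>2)\<close> of \<open>V\<close> gives the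
  path \<open>\<Gamma>\<^sub>1 \<cdot> \<Gamma>\<^sub>2\<^sup>-\<^sup>1\<close>, whose projection \<open>\<beta> \<cdot> \<beta>\<^sup>-\<^sup>1\<close> contracts; lifting the contraction relative to the endpoints
  and to the diagonal makes the path vertical. Thus \<open>V\<close> carries a reserved section.\<close>

section \<open>Lifting for fibrations\<close>

lemma continuous_map_compose_pairs:
  assumes "continuous_map (prod_topology X Y) Z F" "continuous_map W X f" "continuous_map W Y g"
  shows "continuous_map W Z (\<lambda>w. F (f w, g w))"
  using continuous_map_compose[OF continuous_map_pairedI[OF assms(2,3)] assms(1)]
  by (simp add: o_def)

lemma continuous_map_compose':
  assumes "continuous_map Y Z g" "continuous_map X Y f"
  shows "continuous_map X Z (\<lambda>x. g (f x))"
  using continuous_map_compose[OF assms(2,1)] by (simp add: o_def)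

text \<open>If \<open>F\<close> sends \<open>{x} \<times> C\<close> into \<open>V\<close> with
  \<open>C\<close> compact, the tube lemma thickens \<open>x\<close> to an open set with the same
  property, so preimages of subbasic sets are open. This turns homotopies into maps to path
  spaces.\<close>

lemma continuous_map_compact_open_curry:
  assumes F: "continuous_map (prod_topology X K) Y F"
  shows "continuous_map X (compact_open_topology K Y) (\<lambda>x. \<lambda>t\<in>topspace K. F (x, t))"
proof -
  let ?g = "\<lambda>x. \<lambda>t\<in>topspace K. F (x, t)"
  have "openin X (?g -` {f. f ` C \<subseteq> V} \<inter> topspace X)"
    if C: "compactin K C" and V: "openin Y V" for C V
  proof -
    let ?W = "{z \<in> topspace (prod_topology X K). F z \<in> V}"
    have W: "openin (prod_topology X K) ?W"
      using F V by (rule openin_continuous_map_preimage)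
    have CK: "C \<subseteq> topspace K" using C compactin_subset_topspace by blast
    show ?thesis
    proof (subst openin_subopen, intro ballI)
      fix x assume x: "x \<in> ?g -` {f. f ` C \<subseteq> V} \<inter> topspace X"
      then have "{x} \<times> C \<subseteq> ?W" using CK by (fastforce simp: image_subset_iff)
      moreover have "x \<in> topspace X" using x by blast
      ultimately obtain U T where U: "openin X U" "x \<in> U" "C \<subseteq> T" "U \<times> T \<subseteq> ?W"
        using tube_lemma_right[OF W C] by meson
      then have "F (u, t) \<in> V" if "u \<in> U" "t \<in> C" for u t
        using that by blast
      then have "U \<subseteq> ?g -` {f. f ` C \<subseteq> V} \<inter> topspace X"
        using CK openin_subset[OF U(1)] by (auto simp: subset_iff)
      with U(1,2) show "\<exists>T. openin X T \<and> x \<in> T \<and> T \<subseteq> ?g -` {f. f ` C \<subseteq> V} \<inter> topspace X"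
        by blast
    qed
  qed
  moreover have "?g ` topspace X \<subseteq> \<Union>{{f. f ` C \<subseteq> V} | C V. compactin K C \<and> openin Y V}"
    using compactin_empty[of K] openin_empty[of Y] by blast
  ultimately have "continuous_map X
      (topology_generated_by {{f. f ` C \<subseteq> V} | C V. compactin K C \<and> openin Y V}) ?g"
    by (intro continuous_on_generated_topo) auto
  moreover have "continuous_map K Y (?g x)" if "x \<in> topspace X" for x
    using continuous_map_compose_pairs[OF F, of K "\<lambda>_. x" "\<lambda>t. t"] that
    by (auto intro: continuous_map_eq simp: continuous_map_id[unfolded id_def])
  ultimately show ?thesis
    unfolding compact_open_topology_def
    by (intro continuous_map_into_subtopology) auto
qed

text \<open>Local compactness gives a compact neighbourhood \<open>C\<close> of \<open>t\<close>
  that \<open>f\<close> still sends into \<open>V\<close>. The maps sending \<open>C\<close> into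
  \<open>V\<close>, times an open \<open>U \<subseteq> C\<close> around \<open>t\<close>, form an
  open box about \<open>(f, t)\<close>.\<close>

lemma continuous_map_compact_open_eval:
  assumes K: "locally_compact_space K" "Hausdorff_space K"
  shows "continuous_map (prod_topology (compact_open_topology K Y) K) Y (\<lambda>(f, t). f t)"
proof -
  let ?C = "compact_open_topology K Y"
  let ?e = "\<lambda>(f, t). f t"
  have nb: "neighbourhood_base_of (compactin K) K"
    using K locally_compact_space_neighbourhood_base by blast
  have "openin (prod_topology ?C K) {z \<in> topspace (prod_topology ?C K). ?e z \<in> V}"
    if V: "openin Y V" for V
  proof (subst openin_subopen, intro ballI)
    fix z assume z: "z \<in> {z \<in> topspace (prod_topology ?C K). ?e z \<in> V}"
    obtain f t where zft: "z = (f, t)" by fastforce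
    have f: "continuous_map K Y f" and t: "t \<in> topspace K" "f t \<in> V"
      using z by (auto simp: zft topspace_compact_open_topology)
    have "openin K {s \<in> topspace K. f s \<in> V}" using f V by (rule openin_continuous_map_preimage)
    then obtain U C where UC: "openin K U" "compactin K C" "t \<in> U" "U \<subseteq> C" "C \<subseteq> {s \<in> topspace K. f s \<in> V}"
      using nb t unfolding neighbourhood_base_of by (metis (no_types, lifting) mem_Collect_eq)
    let ?S = "{f. f ` C \<subseteq> V} \<inter> topspace ?C"
    have "openin (topology_generated_by {{f. f ` K' \<subseteq> V} | K' V. compactin K K' \<and> openin Y V}) {f. f ` C \<subseteq> V}"
      by (rule topology_generated_by_Basis) (use UC V in blast)
    then have S: "openin ?C ?S"
      unfolding topspace_compact_open_topology
      by (simp add: compact_open_topology_def openin_subtopology_Int)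
    have "openin (prod_topology ?C K) (?S \<times> U)"
      using S UC by (simp add: openin_prod_Times_iff)
    moreover have "z \<in> ?S \<times> U" using z UC by (auto simp: zft)
    moreover have "?S \<times> U \<subseteq> {z \<in> topspace (prod_topology ?C K). ?e z \<in> V}"
      using UC openin_subset[OF UC(1)] by (auto simp: image_subset_iff subset_iff)
    ultimately show "\<exists>T. openin (prod_topology ?C K) T \<and> z \<in> T \<and> T \<subseteq> {z \<in> topspace (prod_topology ?C K). ?e z \<in> V}"
      by blast
  qed
  moreover have "?e \<in> topspace (prod_topology ?C K) \<rightarrow> topspace Y"
    by (auto simp: topspace_compact_open_topology continuous_map_def Pi_iff)
  ultimately show ?thesis unfolding continuous_map_def by auto
qed

section \<open>Universal and relative homotopy lifting\<close>

lemma unit_interval_locally_compact: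
  "locally_compact_space unit_interval" "Hausdorff_space unit_interval"
  by (auto simp: compact_imp_locally_compact_space compact_space_subtopology Hausdorff_space_subtopology)

text \<open>The universal lifting problem over the mapping path space, one of the test spaces in the
  definition, yields lifts for test spaces of any type.\<close>

lemma hurewicz_fibration_homotopy_lifting:
  fixes X :: "'x topology" and E :: "'a topology" and B :: "'b topology"
  assumes fib: "hurewicz_fibration E B p"
  shows "homotopy_lifting_property X E B p"
  unfolding homotopy_lifting_property_def
proof (intro allI impI, elim conjE)
  fix f H
  assume f: "continuous_map X E f" and H: "continuous_map (prod_topology X unit_interval) B H"
    and Hf: "\<forall>x\<in>topspace X. H (x, 0) = p (f x)"
  let ?BI = "compact_open_topology unit_interval B"
  define P where "P = subtopology (prod_topology E ?BI) {(e, \<beta>). p e = \<beta> 0}"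
  have "continuous_map (prod_topology P unit_interval) B (\<lambda>((e, \<beta>), t). \<beta> t)"
  proof -
    have "continuous_map (prod_topology P unit_interval) P fst" by (rule continuous_map_fst)
    then have "continuous_map (prod_topology P unit_interval) (prod_topology E ?BI) fst"
      unfolding P_def by (rule continuous_map_into_fulltopology)
    then have 1: "continuous_map (prod_topology P unit_interval) ?BI (snd \<circ> fst)"
      by (rule continuous_map_snd_of)
    show ?thesis
      using continuous_map_compose_pairs[OF continuous_map_compact_open_eval[OF unit_interval_locally_compact] 1
          continuous_map_snd]
      by (simp add: case_prod_unfold)
  qed
  moreover have "continuous_map P E fst"
    unfolding P_def by (rule continuous_map_subtopology_fst)
  moreover have "\<forall>z\<in>topspace P. (\<lambda>((e, \<beta>), t). \<beta> t) (z, 0) = p (fst z)"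
    by (auto simp: P_def)
  moreover have "homotopy_lifting_property P E B p"
    using fib unfolding hurewicz_fibration_def by blast
  ultimately have "\<exists>G. continuous_map (prod_topology P unit_interval) E G \<and>
      (\<forall>z\<in>topspace P. G (z, 0) = fst z) \<and>
      (\<forall>z\<in>topspace P. \<forall>t\<in>{0..1}. p (G (z, t)) = (\<lambda>((e, \<beta>), t). \<beta> t) (z, t))"
    unfolding homotopy_lifting_property_def by blast
  then obtain G where G: "continuous_map (prod_topology P unit_interval) E G"
    and G0: "\<And>z. z \<in> topspace P \<Longrightarrow> G (z, 0) = fst z"
    and pG: "\<And>z t. z \<in> topspace P \<Longrightarrow> t \<in> {0..1} \<Longrightarrow> p (G (z, t)) = snd z t"
    by (auto simp: case_prod_unfold)
  \<comment> \<open>The pair \<open>(f, H)\<close> is the pullback of the universal lifting problem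
    along \<open>j\<close>, so composing the universal lift \<open>G\<close> with \<open>j\<close>
    solves it.\<close>
  define j where "j x = (f x, \<lambda>t\<in>{0..1}. H (x, t))" for x
  have "continuous_map X ?BI (\<lambda>x. \<lambda>t\<in>{0..1}. H (x, t))"
    using continuous_map_compact_open_curry[OF H] by simp
  then have "continuous_map X (prod_topology E ?BI) j"
    unfolding j_def using f by (intro continuous_map_pairedI)
  then have j: "continuous_map X P j"
    unfolding P_def using Hf
    by (intro continuous_map_into_subtopology) (auto simp: j_def)
  then have jP: "x \<in> topspace X \<Longrightarrow> j x \<in> topspace P" for x
    by (auto simp: continuous_map_def)
  have "continuous_map (prod_topology X unit_interval) P (\<lambda>z. j (fst z))"
    by (rule continuous_map_compose'[OF j continuous_map_fst])
  from continuous_map_compose_pairs[OF G this continuous_map_snd]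
  have "continuous_map (prod_topology X unit_interval) E (\<lambda>z. G (j (fst z), snd z))" .
  moreover have "\<forall>x\<in>topspace X. G (j x, 0) = f x"
    using G0 jP by (simp add: j_def)
  moreover have "\<forall>x\<in>topspace X. \<forall>t\<in>{0..1}. p (G (j x, t)) = H (x, t)"
    using pG jP by (simp add: j_def)
  ultimately show "\<exists>G. continuous_map (prod_topology X unit_interval) E G \<and>
            (\<forall>x\<in>topspace X. G (x, 0) = f x) \<and>
            (\<forall>x\<in>topspace X. \<forall>t\<in>{0..1}. p (G (x, t)) = H (x, t))"
    by (intro exI[of _ "\<lambda>z. G (j (fst z), snd z)"]) simp
qed

text \<open>Run the homotopy at speed \<open>1 / \<phi>\<close>, lift, and stop at time \<open>\<phi>\<close>: where \<open>\<phi>\<close> vanishes the lift has no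
  time to move. There \<open>t / \<phi> x = 0\<close> by convention, which is harmless because \<open>H\<close> is stationary.\<close>

lemma homotopy_lifting_relative:
  assumes hlp: "homotopy_lifting_property X E B p"
    and \<phi>: "continuous_map X euclideanreal \<phi>"
    and \<phi>01: "\<And>x. x \<in> topspace X \<Longrightarrow> \<phi> x \<in> {0..1}"
    and f: "continuous_map X E f"
    and H: "continuous_map (prod_topology X unit_interval) B H"
    and H0: "\<And>x. x \<in> topspace X \<Longrightarrow> H (x, 0) = p (f x)"
    and stat: "\<And>x t. x \<in> topspace X \<Longrightarrow> \<phi> x = 0 \<Longrightarrow> t \<in> {0..1} \<Longrightarrow> H (x, t) = p (f x)"
  obtains G where "continuous_map (prod_topology X unit_interval) E G"
    "\<And>x. x \<in> topspace X \<Longrightarrow> G (x, 0) = f x"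
    "\<And>x t. x \<in> topspace X \<Longrightarrow> t \<in> {0..1} \<Longrightarrow> p (G (x, t)) = H (x, t)"
    "\<And>x t. x \<in> topspace X \<Longrightarrow> \<phi> x = 0 \<Longrightarrow> t \<in> {0..1} \<Longrightarrow> G (x, t) = f x"
proof -
  let ?XI = "prod_topology X unit_interval"
  define K where "K = (\<lambda>(x, t). H (x, min 1 (t / \<phi> x)))"
  have sub: "continuous_map ?XI euclideanreal snd"
    using continuous_map_into_fulltopology continuous_map_snd by blast
  have \<phi>': "continuous_map ?XI euclideanreal (\<lambda>z. \<phi> (fst z))"
    by (rule continuous_map_compose'[OF \<phi> continuous_map_fst])
  have K: "continuous_map ?XI B K"
  proof -
    let ?P = "{z \<in> topspace ?XI. \<phi> (fst z) \<noteq> 0}"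
    have Popen: "openin ?XI ?P"
      using openin_continuous_map_preimage[OF \<phi>', of "-{0}"] by (simp add: openin_open_eq open_Compl)
    have KP: "continuous_map (subtopology ?XI ?P) B K"
    proof -
      have a: "continuous_map (subtopology ?XI ?P) X fst"
        by (simp add: continuous_map_from_subtopology continuous_map_fst)
      have "continuous_map (subtopology ?XI ?P) euclideanreal (\<lambda>z. min 1 (snd z / \<phi> (fst z)))"
        by (intro continuous_map_real_min continuous_map_real_divide continuous_map_from_subtopology sub \<phi>') auto
      then have "continuous_map (subtopology ?XI ?P) unit_interval (\<lambda>z. min 1 (snd z / \<phi> (fst z)))"
      proof (rule continuous_map_into_subtopology, intro Pi_I)
        fix z assume "z \<in> topspace (subtopology ?XI ?P)"
        then have "\<phi> (fst z) \<in> {0..1}" "snd z \<in> {0..1}"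
          using \<phi>01[of "fst z"] by (simp_all add: mem_Times_iff)
        then show "min 1 (snd z / \<phi> (fst z)) \<in> {0..1}" by simp
      qed
      from continuous_map_compose_pairs[OF H a this] show ?thesis
        by (simp add: K_def case_prod_unfold)
    qed
    have "openin ?XI {z \<in> topspace ?XI. K z \<in> V}" if V: "openin B V" for V
    proof (subst openin_subopen, intro ballI)
      fix z assume z: "z \<in> {z \<in> topspace ?XI. K z \<in> V}"
      show "\<exists>T. openin ?XI T \<and> z \<in> T \<and> T \<subseteq> {z \<in> topspace ?XI. K z \<in> V}"
      proof (cases "\<phi> (fst z) = 0")
        case False
        have "openin (subtopology ?XI ?P) {z \<in> topspace (subtopology ?XI ?P). K z \<in> V}"
          using KP V by (rule openin_continuous_map_preimage)
        then have "openin ?XI {z \<in> topspace (subtopology ?XI ?P). K z \<in> V}"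
          using Popen openin_trans_full by blast
        then show ?thesis using z False by (intro exI conjI) auto
      next
        case True
        obtain x t where xt: "z = (x, t)" by fastforce
        have x: "x \<in> topspace X" "\<phi> x = 0" "p (f x) \<in> V"
          using z True H0 by (auto simp: xt K_def)
        \<comment> \<open>The rescaled time may have no limit at \<open>x\<close>, but
          \<open>H\<close> keeps all of \<open>{x} \<times> {0..1}\<close> in \<open>V\<close>. The
          tube lemma gives a \<open>U\<close> over which \<open>H\<close> stays in \<open>V\<close>
          at every time, whatever the rescaled time is.\<close>
        let ?W = "{z \<in> topspace ?XI. H z \<in> V}"
        have W: "openin ?XI ?W" using H V by (rule openin_continuous_map_preimage)
        have sub: "{x} \<times> {0..1} \<subseteq> ?W" using x stat by auto
        have "compactin unit_interval {0..1}" by (simp add: compactin_subtopology)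
        from tube_lemma_right[OF W this x(1) sub] obtain U T
          where U: "openin X U" "x \<in> U" "{0..1} \<subseteq> T" "U \<times> T \<subseteq> ?W" by blast
        have "U \<times> {0..1} \<subseteq> {z \<in> topspace ?XI. K z \<in> V}"
        proof
          fix y assume y: "y \<in> U \<times> {0..1::real}"
          have u: "fst y \<in> topspace X" using y openin_subset[OF U(1)] by auto
          have "min 1 (snd y / \<phi> (fst y)) \<in> {0..1}" using \<phi>01[OF u] y by auto
          then have "(fst y, min 1 (snd y / \<phi> (fst y))) \<in> U \<times> T" using U(3) y by (auto dest: subsetD)
          then have "(fst y, min 1 (snd y / \<phi> (fst y))) \<in> ?W" using U(4) by (rule subsetD[rotated])
          then show "y \<in> {z \<in> topspace ?XI. K z \<in> V}" using y u
            by (auto simp: K_def case_prod_unfold)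
        qed
        moreover have "openin ?XI (U \<times> {0..1})"
          using U(1) openin_topspace[of unit_interval] by (simp add: openin_prod_Times_iff)
        ultimately show ?thesis using z U(2) by (intro exI[of _ "U \<times> {0..1}"]) (auto simp: xt)
      qed
    qed
    moreover have "K \<in> topspace ?XI \<rightarrow> topspace B"
    proof
      fix z assume z: "z \<in> topspace ?XI"
      then have "(fst z, min 1 (snd z / \<phi> (fst z))) \<in> topspace ?XI"
        using \<phi>01[of "fst z"] by auto
      from funcset_mem[OF continuous_map_funspace[OF H] this] show "K z \<in> topspace B"
        by (simp add: K_def case_prod_unfold)
    qed
    ultimately show ?thesis unfolding continuous_map_def by auto
  qed
  have "\<forall>x\<in>topspace X. K (x, 0) = p (f x)" using H0 by (simp add: K_def)
  then obtain G where G: "continuous_map ?XI E G" "\<And>x. x \<in> topspace X \<Longrightarrow> G (x, 0) = f x"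
    "\<And>x t. x \<in> topspace X \<Longrightarrow> t \<in> {0..1} \<Longrightarrow> p (G (x, t)) = K (x, t)"
    using hlp f K unfolding homotopy_lifting_property_def by blast
  \<comment> \<open>Evaluating the lift at time \<open>t * \<phi> x\<close> undoes the speed
    \<open>1 / \<phi> x\<close>: where \<phi> is positive,
    \<open>K (x, t * \<phi> x) = H (x, t)\<close>.\<close>
  have m: "t * \<phi> x \<in> {0..1}" if "x \<in> topspace X" "t \<in> {0..1}" for x t
    using \<phi>01[OF that(1)] that(2) by (simp add: mult_le_one)
  have "continuous_map ?XI unit_interval (\<lambda>z. snd z * \<phi> (fst z))"
    using m by (intro continuous_map_into_subtopology continuous_map_real_mult sub \<phi>') (simp add: Pi_iff mem_Times_iff)
  from continuous_map_compose_pairs[OF G(1) continuous_map_fst this]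
  have 1: "continuous_map ?XI E (\<lambda>z. G (fst z, snd z * \<phi> (fst z)))" .
  show thesis
  proof (rule that[OF 1], goal_cases)
    case (2 x t)
    then show ?case using G(3)[OF 2(1) m[OF 2]] stat[of x t] H0[of x]
      by (cases "\<phi> x = 0") (auto simp: K_def min_def)
  qed (use G(2) in auto)
qed

section \<open>The Kuratowski embedding\<close>

text \<open>A point goes to the family of its truncated distances. Over the index type
  \<open>'a discrete\<close> every bounded function is continuous, so the target is the Banach space
  of all bounded functions. Truncation keeps coordinates in \<open>{0..1}\<close>, a bound on which
  the later approximation relies.\<close>

theorem kuratowski_embedding:
  fixes X :: "'a topology"
  assumes "metrizable_space X"
  obtains \<kappa> :: "'a \<Rightarrow> 'a discrete \<Rightarrow>\<^sub>C real"
  where "homeomorphic_map X (top_of_set (\<kappa> ` topspace X)) \<kappa>"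
    "\<And>x i. \<kappa> x i \<in> {0..1}"
proof -
  obtain M d where Md: "Metric_space M d" and X: "X = Metric_space.mtopology M d"
    using assms unfolding metrizable_space_def by blast
  interpret Metric_space M d by (rule Md)
  \<comment> \<open>Indices run over the whole type, hence the default value 0 off the carrier
    \<open>M\<close>.\<close>
  define e where "e x y = (if x \<in> M \<and> y \<in> M then min 1 (d x y) else 0)" for x y
  have tri: "\<bar>e x z - e y z\<bar> \<le> min 1 (d x y)" if "x \<in> M" "y \<in> M" for x y z
    using that triangle[of x y z] triangle[of y x z] commute[of x y]
    by (auto simp: e_def min_def) (use nonneg[of x z] nonneg[of y z] in linarith)
  define \<kappa> :: "'a \<Rightarrow> 'a discrete \<Rightarrow>\<^sub>C real" where "\<kappa> x = Bcontfun (\<lambda>i. e x (of_discrete i))" for x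
  have e01: "e x y \<in> {0..1}" for x y by (auto simp: e_def)
  have "(\<lambda>i. e x (of_discrete i)) \<in> bcontfun" for x
  proof (rule bcontfun_normI)
    show "continuous_on UNIV (\<lambda>i. e x (of_discrete i))"
      by (simp add: continuous_on_open_vimage open_discrete)
    show "norm (e x (of_discrete i)) \<le> 1" for i using e01[of x "of_discrete i"] by simp
  qed
  then have ap: "apply_bcontfun (\<kappa> x) i = e x (of_discrete i)" for x i
    unfolding \<kappa>_def by (simp add: Bcontfun_inverse)
  have iso: "dist (\<kappa> x) (\<kappa> y) = min 1 (d x y)" if "x \<in> M" "y \<in> M" for x y
  proof (rule antisym)
    show "dist (\<kappa> x) (\<kappa> y) \<le> min 1 (d x y)"
      using tri[OF that] by (intro dist_bound) (simp add: ap dist_real_def)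
    \<comment> \<open>The coordinate at \<open>y\<close> already realises the distance, because
      \<open>e y y = 0\<close>.\<close>
    show "min 1 (d x y) \<le> dist (\<kappa> x) (\<kappa> y)"
      using dist_bounded[of "\<kappa> x" "discrete y" "\<kappa> y"] that
      by (simp add: ap dist_real_def e_def discrete_inverse)
  qed
  have X': "topspace X = M" by (simp add: X)
  have "inj_on \<kappa> M"
    by (rule inj_onI) (metis iso dist_self min_def zero zero_neq_one)
  moreover have "continuous_map X (top_of_set (\<kappa> ` M)) \<kappa>"
  proof (rule continuous_map_into_subtopology)
    have "openin X {x \<in> M. \<kappa> x \<in> V}" if "open V" for V
      unfolding X openin_mtopology
    proof (intro conjI strip)
      fix x assume x: "x \<in> {x \<in> M. \<kappa> x \<in> V}"
      then obtain r where r: "r > 0" "\<And>y. dist y (\<kappa> x) < r \<Longrightarrow> y \<in> V"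
        using \<open>open V\<close> unfolding open_dist by blast
      have "mball x r \<subseteq> {x \<in> M. \<kappa> x \<in> V}"
        using r(2) iso x by (auto simp: commute)
      then show "\<exists>r>0. mball x r \<subseteq> {x \<in> M. \<kappa> x \<in> V}" using r by blast
    qed auto
    then show "continuous_map X euclidean \<kappa>"
      by (simp add: continuous_map_def X')
  qed (simp add: X')
  moreover have "open_map X (top_of_set (\<kappa> ` M)) \<kappa>"
    unfolding open_map_def
  proof (intro strip)
    fix U assume U: "openin X U"
    show "openin (top_of_set (\<kappa> ` M)) (\<kappa> ` U)"
      unfolding openin_euclidean_subtopology_iff
    proof (intro conjI ballI)
      show "\<kappa> ` U \<subseteq> \<kappa> ` M" using openin_subset[OF U] X' by auto
      fix z assume "z \<in> \<kappa> ` U"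
      then obtain x where x: "x \<in> U" "z = \<kappa> x" by blast
      then obtain r where r: "r > 0" "mball x r \<subseteq> U" using U unfolding X openin_mtopology by blast
      have xM: "x \<in> M" using x openin_subset[OF U] X' by auto
      have "y \<in> U" if "y \<in> M" "dist (\<kappa> y) z < min 1 r" for y
        using that iso[OF \<open>y \<in> M\<close> xM] r xM x by (auto simp: commute min_def split: if_splits)
      then show "\<exists>e>0. \<forall>x'\<in>\<kappa> ` M. dist x' z < e \<longrightarrow> x' \<in> \<kappa> ` U"
        using r(1) by (intro exI[of _ "min 1 r"]) auto
    qed
  qed
  ultimately have "homeomorphic_map X (top_of_set (\<kappa> ` topspace X)) \<kappa>"
    by (intro bijective_open_imp_homeomorphic_map) (auto simp: X')
  then show thesis using that e01 ap by metis
qed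

text \<open>After the embedding, \<open>S\<close> is the trace of a closed set \<open>T\<close> of a
  metric space, and the truncated \<open>infdist\<close> to \<open>T\<close> vanishes exactly there.
  The empty set is treated apart because \<open>infdist x {} = 0\<close>.\<close>

lemma metrizable_space_zero_set:
  assumes X: "metrizable_space X" and S: "closedin X S"
  obtains f where "continuous_map X euclideanreal f" "\<And>x. f x \<in> {0..1}"
    "\<And>x. x \<in> topspace X \<Longrightarrow> f x = 0 \<longleftrightarrow> x \<in> S"
proof (cases "S = {}")
  case True
  then show thesis using that[of "\<lambda>_. 1"] by simp
next
  case False
  obtain \<kappa> :: "'a \<Rightarrow> 'a discrete \<Rightarrow>\<^sub>C real"
    where h: "homeomorphic_map X (top_of_set (\<kappa> ` topspace X)) \<kappa>"
    using kuratowski_embedding[OF X] by metis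
  have "closedin (top_of_set (\<kappa> ` topspace X)) (\<kappa> ` S)"
    using homeomorphic_map_closedness_eq[OF h] S by blast
  then obtain T where T: "closed T" "\<kappa> ` S = \<kappa> ` topspace X \<inter> T"
    by (auto simp: closedin_closed)
  then have Tne: "T \<noteq> {}" using False by auto
  have inj: "inj_on \<kappa> (topspace X)" using h homeomorphic_imp_injective_map by blast
  have SX: "S \<subseteq> topspace X" using S closedin_subset by blast
  have \<kappa>: "continuous_map X euclidean \<kappa>"
    using homeomorphic_imp_continuous_map[OF h] by (rule continuous_map_into_fulltopology)
  have "continuous_map euclidean euclideanreal (\<lambda>y. min 1 (infdist y T))"
    by (simp add: continuous_map_iff_continuous2 continuous_intros)
  from continuous_map_compose[OF \<kappa> this]
  have "continuous_map X euclideanreal (\<lambda>x. min 1 (infdist (\<kappa> x) T))" by (simp add: o_def)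
  moreover have "min 1 (infdist (\<kappa> x) T) = 0 \<longleftrightarrow> x \<in> S" if x: "x \<in> topspace X" for x
  proof -
    have "min 1 (infdist (\<kappa> x) T) = 0 \<longleftrightarrow> \<kappa> x \<in> T"
      using in_closed_iff_infdist_zero[OF T(1) Tne, of "\<kappa> x"] by (auto simp: min_def)
    also have "\<dots> \<longleftrightarrow> \<kappa> x \<in> \<kappa> ` S" using x T(2) by auto
    also have "\<dots> \<longleftrightarrow> x \<in> S" using inj SX x by (auto simp: inj_on_def)
    finally show ?thesis .
  qed
  ultimately show thesis by (intro that) (auto simp: infdist_nonneg)
qed

section \<open>Reserved sections and deformations into the diagonal\<close>

lemma closedin_diagonal_fibre_product:
  assumes "Hausdorff_space E"
  shows "closedin (fibre_product E p) (diagonal E)"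
proof -
  have "closedin (prod_topology E E) (diagonal E)"
    using assms unfolding Hausdorff_space_closedin_diagonal diagonal_def .
  moreover have "diagonal E \<subseteq> {(e1, e2). p e1 = p e2}" by (auto simp: diagonal_def)
  ultimately show ?thesis
    unfolding fibre_product_def by (simp add: closedin_subset_topspace closedin_subtopology) blast
qed

lemma topspace_fibre_product:
  "topspace (fibre_product E p) = {(x, y). x \<in> topspace E \<and> y \<in> topspace E \<and> p x = p y}"
  by (auto simp: fibre_product_def)

lemma diagonal_subset_fibre_product: "diagonal E \<subseteq> topspace (fibre_product E p)"
  by (auto simp: diagonal_def topspace_fibre_product)

lemma continuous_map_fibre_product_coordinates:
  "continuous_map (fibre_product E p) E fst" "continuous_map (fibre_product E p) E snd"
  unfolding fibre_product_def by (auto intro: continuous_map_subtopology_fst continuous_map_subtopology_snd)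

text \<open>The deformation moves both coordinates of \<open>z\<close> to a common point along paths
  with equal projection. The path out along the first and back along the second therefore projects
  to a path that retraces itself. Lifting its contraction relative to the ends and the diagonal
  gives a path in one fibre.\<close>

lemma reserved_section_of_homotopy:
  assumes fib: "hurewicz_fibration E B p"
    and Z: "metrizable_space (fibre_product E p)" and E: "Hausdorff_space E"
    and V: "diagonal E \<subseteq> V" "V \<subseteq> topspace (fibre_product E p)"
    and hom: "homotopic_with (\<lambda>f. \<forall>z\<in>diagonal E. f z = z)
      (subtopology (fibre_product E p) V) (fibre_product E p) id g"
    and g: "g ` V \<subseteq> diagonal E"
  obtains \<sigma> where "reserved_section E p V \<sigma>"
proof -
  let ?Z = "fibre_product E p" and ?I = unit_interval
  let ?V = "subtopology ?Z V"
  have tV: "topspace ?V = V" using V by auto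
  obtain h where h: "continuous_map (prod_topology ?I ?V) ?Z h"
    and h0: "\<And>z. h (0, z) = z" and h1: "\<And>z. h (1, z) = g z"
    and hd: "\<And>t z. t \<in> {0..1} \<Longrightarrow> z \<in> diagonal E \<Longrightarrow> h (t, z) = z"
    using hom unfolding homotopic_with_def by auto
  have hZ: "h (t, z) \<in> topspace ?Z" if "t \<in> {0..1}" "z \<in> V" for t z
    using funcset_mem[OF continuous_map_funspace[OF h], of "(t, z)"] that V(2) by auto
  obtain \<delta> where \<delta>: "continuous_map ?Z euclideanreal \<delta>" "\<And>z. \<delta> z \<in> {0..1}"
    and \<delta>0: "\<And>z. z \<in> topspace ?Z \<Longrightarrow> \<delta> z = 0 \<longleftrightarrow> z \<in> diagonal E"
    using metrizable_space_zero_set[OF Z closedin_diagonal_fibre_product[OF E]] by metis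
  \<comment> \<open>A tent: 0 at both ends, 1 at \<open>1/2\<close>. The path \<alpha> below changes
    from the first to the second coordinate at the peak, where \<open>h (1, z)\<close> lies on the
    diagonal.\<close>
  define m :: "real \<Rightarrow> real" where "m t = min (2 * t) (2 - 2 * t)" for t
  have m01: "m t \<in> {0..1}" if "t \<in> {0..1}" for t using that by (auto simp: m_def)
  let ?X = "prod_topology ?V ?I"
  have mc: "continuous_map ?X euclideanreal (\<lambda>x. m (snd x))"
    unfolding m_def
    by (intro continuous_map_real_min continuous_map_diff continuous_map_real_mult_left
        continuous_map_into_fulltopology[OF continuous_map_snd] continuous_map_const[THEN iffD2]) auto
  have hm: "continuous_map ?X ?Z (\<lambda>x. h (m (snd x), fst x))"
    using m01 by (intro continuous_map_compose_pairs[OF h] continuous_map_into_subtopology mc continuous_map_fst) auto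
  define \<alpha> where "\<alpha> x = (if snd x \<le> 1/2 then fst (h (m (snd x), fst x)) else snd (h (m (snd x), fst x)))"
    for x :: "('a \<times> 'a) \<times> real"
  have p_fs: "p (snd (h (t, z))) = p (fst (h (t, z)))" if "t \<in> {0..1}" "z \<in> V" for t z
    using hZ[OF that] by (auto simp: topspace_fibre_product)
  have \<alpha>: "continuous_map ?X E \<alpha>"
    unfolding \<alpha>_def
  proof (rule continuous_map_cases_le)
    fix x :: "('a \<times> 'a) \<times> real" assume "x \<in> topspace ?X" "snd x = 1/2"
    then have "fst x \<in> V" "m (snd x) = 1" by (auto simp: m_def tV mem_Times_iff)
    then have "h (m (snd x), fst x) \<in> diagonal E" using h1 g by auto
    then show "fst (h (m (snd x), fst x)) = snd (h (m (snd x), fst x))"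
      by (auto simp: diagonal_def)
  qed (auto intro!: continuous_map_from_subtopology continuous_map_into_fulltopology[OF continuous_map_snd]
      continuous_map_compose'[OF _ hm] continuous_map_fibre_product_coordinates)
  \<comment> \<open>Scaling the tent by \<open>1 - snd y\<close> contracts the projected path; at
    time 1 it is constant at \<open>p (fst z)\<close> because \<open>h (0, z) = z\<close>.\<close>
  define H where "H y = p (fst (h ((1 - snd y) * m (snd (fst y)), fst (fst y))))" for y :: "(('a \<times> 'a) \<times> real) \<times> real"
  have "continuous_map E B p" using fib unfolding hurewicz_fibration_def by blast
  moreover have hs: "continuous_map (prod_topology ?X ?I) ?Z (\<lambda>y. h ((1 - snd y) * m (snd (fst y)), fst (fst y)))"
  proof (rule continuous_map_compose_pairs[OF h], rule continuous_map_into_subtopology,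
      intro continuous_map_real_mult continuous_map_diff)
    show "continuous_map (prod_topology ?X ?I) euclideanreal snd"
      by (rule continuous_map_into_fulltopology[OF continuous_map_snd])
    show "continuous_map (prod_topology ?X ?I) euclideanreal (\<lambda>y. m (snd (fst y)))"
      by (rule continuous_map_compose'[OF mc continuous_map_fst])
    show "continuous_map (prod_topology ?X ?I) ?V (\<lambda>y. fst (fst y))"
      by (rule continuous_map_compose'[OF continuous_map_fst continuous_map_fst])
    have "(1 - s) * m t \<in> {0..1}" if "s \<in> {0..1}" "t \<in> {0..1}" for s t
      using m01[OF that(2)] that(1) by (simp add: mult_le_one)
    then show "(\<lambda>y. (1 - snd y) * m (snd (fst y))) \<in> topspace (prod_topology ?X ?I) \<rightarrow> {0..1}"
      by (simp add: Pi_iff mem_Times_iff)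
  qed auto
  ultimately have H: "continuous_map (prod_topology ?X ?I) B H"
    unfolding H_def
    using continuous_map_compose'[OF _ continuous_map_compose'[OF continuous_map_fibre_product_coordinates(1) hs]] by blast
  have H0: "H (x, 0) = p (\<alpha> x)" if "x \<in> topspace ?X" for x
    using p_fs[OF m01, of "snd x" "fst x"] that by (auto simp: H_def \<alpha>_def)
  \<comment> \<open>\<phi> vanishes exactly where the lift must not move: on the diagonal, where
    \<open>h\<close> is constant in time, and at \<open>t = 0\<close> and \<open>t = 1\<close>,
    where the tent is 0. The contraction is stationary there.\<close>
  define \<phi> where "\<phi> x = \<delta> (fst x) * m (snd x)" for x
  have \<phi>: "continuous_map ?X euclideanreal \<phi>"
    unfolding \<phi>_def
    by (intro continuous_map_real_mult mc continuous_map_compose'[OF \<delta>(1)]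
        continuous_map_into_fulltopology[OF continuous_map_fst])
  have \<phi>01: "\<phi> x \<in> {0..1}" if "x \<in> topspace ?X" for x
    using \<delta>(2)[of "fst x"] m01[of "snd x"] that by (auto simp: \<phi>_def mult_le_one)
  have \<phi>0: "fst x \<in> diagonal E \<or> snd x = 0 \<or> snd x = 1" if "x \<in> topspace ?X" "\<phi> x = 0" for x
    using \<delta>0[of "fst x"] that by (auto simp: \<phi>_def m_def min_def split: if_splits)
  have \<phi>0': "\<phi> (z, t) = 0" if "z \<in> diagonal E \<or> t = 0 \<or> t = 1" for z t
    using that \<delta>0[of z] diagonal_subset_fibre_product[of E p] by (auto simp: \<phi>_def m_def)
  have stat: "H (x, s) = p (\<alpha> x)" if x: "x \<in> topspace ?X" "\<phi> x = 0" and s: "s \<in> {0..1}" for x s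
  proof -
    have "h ((1 - s) * m (snd x), fst x) = h (m (snd x), fst x)"
    proof -
      have "(1 - s) * m (snd x) \<in> {0..1}" "m (snd x) \<in> {0..1}"
        using m01[of "snd x"] s x by (auto simp: mult_le_one)
      then have "h ((1 - s) * m (snd x), fst x) = h (m (snd x), fst x)" if "fst x \<in> diagonal E"
        using hd[OF _ that] by metis
      then show ?thesis using \<phi>0[OF x] by (auto simp: m_def)
    qed
    then show ?thesis using H0[OF x(1)] by (simp add: H_def)
  qed
  obtain G where G: "continuous_map (prod_topology ?X ?I) E G"
    and pG: "\<And>x s. x \<in> topspace ?X \<Longrightarrow> s \<in> {0..1} \<Longrightarrow> p (G (x, s)) = H (x, s)"
    and Gstat: "\<And>x s. x \<in> topspace ?X \<Longrightarrow> \<phi> x = 0 \<Longrightarrow> s \<in> {0..1} \<Longrightarrow> G (x, s) = \<alpha> x"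
    by (rule homotopy_lifting_relative[OF hurewicz_fibration_homotopy_lifting[OF fib] \<phi> _ \<alpha> H])
       (use \<phi>01 H0 stat in blast)+
  define \<sigma> where "\<sigma> z = (\<lambda>t\<in>{0..1}. G ((z, t), 1))" for z
  have "continuous_map ?X E (\<lambda>x. G (x, 1))"
    by (intro continuous_map_compose_pairs[OF G]) (auto simp: continuous_map_id[unfolded id_def])
  then have "continuous_map ?X E (\<lambda>(z, t). G ((z, t), 1))" by (simp add: case_prod_unfold)
  from continuous_map_compact_open_curry[OF this]
  have \<sigma>c: "continuous_map ?V (compact_open_topology ?I E) \<sigma>"
    by (simp add: \<sigma>_def[abs_def])
  have pcon: "p (\<sigma> z t) = p (fst z)" if "z \<in> V" "t \<in> {0..1}" for z t
    using that pG[of "(z, t)" 1] subsetD[OF V(2) that(1)] by (simp add: \<sigma>_def H_def h0)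
  have "continuous_map ?V (fibrewise_path_space E p) \<sigma>"
    unfolding fibrewise_path_space_def using pcon tV
    by (intro continuous_map_into_subtopology \<sigma>c) (auto simp: Pi_iff)
  moreover have "endpoints (\<sigma> z) = z" if "z \<in> V" for z
    using that Gstat[of "(z, 0)" 1] Gstat[of "(z, 1)" 1] \<phi>0'[of z] subsetD[OF V(2) that]
    by (simp add: endpoints_def \<sigma>_def \<alpha>_def m_def h0)
  moreover have "\<sigma> (e, e) = const_path e" if "e \<in> topspace E" for e
  proof
    fix t
    have d: "(e, e) \<in> diagonal E" using that by (auto simp: diagonal_def)
    then have "G (((e, e), t), 1) = e" if "t \<in> {0..1}"
      using Gstat[of "((e, e), t)" 1] \<phi>0'[of "(e, e)" t] subsetD[OF V(1) d] subsetD[OF V(2) subsetD[OF V(1) d]] d that hd[OF m01[OF that] d] by (auto simp: \<alpha>_def)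
    then show "\<sigma> (e, e) t = const_path e t"
      by (simp add: \<sigma>_def const_path_def restrict_def)
  qed
  ultimately have "reserved_section E p V \<sigma>" unfolding reserved_section_def by blast
  then show thesis by (rule that)
qed

text \<open>The first coordinate slides along the path \<open>s z\<close> while the second stays
  fixed. The path lies in one fibre, so the pair remains in the fibre product; it ends on the
  diagonal.\<close>

lemma homotopy_of_reserved_section:
  assumes s: "reserved_section E p U s"
    and U: "diagonal E \<subseteq> U" "U \<subseteq> topspace (fibre_product E p)"
  obtains g where "g ` U \<subseteq> diagonal E"
    "homotopic_with (\<lambda>f. \<forall>z\<in>diagonal E. f z = z)
      (subtopology (fibre_product E p) U) (fibre_product E p) id g"
proof -
  let ?Z = "fibre_product E p" and ?I = unit_interval
  let ?U = "subtopology ?Z U"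
  have tU: "topspace ?U = U" using U by auto
  have sc: "continuous_map ?U (fibrewise_path_space E p) s"
    and ends: "\<And>z. z \<in> U \<Longrightarrow> s z 0 = fst z \<and> s z 1 = snd z"
    and sd: "\<And>z. z \<in> diagonal E \<Longrightarrow> s z = const_path (fst z)"
    using s U unfolding reserved_section_def endpoints_def by (auto simp: diagonal_def prod_eq_iff)
  have sc': "continuous_map ?U (compact_open_topology ?I E) s"
    using sc unfolding fibrewise_path_space_def by (rule continuous_map_into_fulltopology)
  \<comment> \<open>Extended by the identity off \<open>U\<close>, since
    \<open>homotopic_with_def\<close> prescribes the initial value at all points of the
    type.\<close>
  define h where "h = (\<lambda>(t, z). if z \<in> U then (s z t, snd z) else z)"
  have fib: "p (s z t) = p (snd z)" if "z \<in> U" "t \<in> {0..1}" for z t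
  proof -
    have "s z \<in> topspace (fibrewise_path_space E p)"
      using funcset_mem[OF continuous_map_funspace[OF sc], of z] that(1) U(2) by auto
    then obtain b where "\<forall>t\<in>{0..1}. p (s z t) = b" unfolding fibrewise_path_space_def by auto
    then show ?thesis using that ends[OF that(1)] by (metis atLeastAtMost_iff order_refl zero_le_one)
  qed
  have 1: "continuous_map (prod_topology ?I ?U) E (\<lambda>x. s (snd x) (fst x))"
    using continuous_map_compose_pairs[OF continuous_map_compact_open_eval[OF unit_interval_locally_compact]
        continuous_map_compose'[OF sc' continuous_map_snd] continuous_map_fst]
    by simp
  have 2: "continuous_map (prod_topology ?I ?U) E (\<lambda>x. snd (snd x))"
    by (rule continuous_map_compose'[OF continuous_map_fibre_product_coordinates(2)])
       (rule continuous_map_into_fulltopology[OF continuous_map_snd])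
  have "continuous_map (prod_topology ?I ?U) ?Z (\<lambda>x. (s (snd x) (fst x), snd (snd x)))"
    using continuous_map_pairedI[OF 1 2] fib tU unfolding fibre_product_def
    by (intro continuous_map_into_subtopology) (auto simp: fibre_product_def)
  then have hc: "continuous_map (prod_topology ?I ?U) ?Z h"
    by (rule continuous_map_eq) (auto simp: h_def tU)
  show thesis
  proof (rule that)
    show "(\<lambda>z. h (1, z)) ` U \<subseteq> diagonal E"
    proof
      fix y assume "y \<in> (\<lambda>z. h (1, z)) ` U"
      then obtain z where z: "z \<in> U" "y = (snd z, snd z)" using ends by (auto simp: h_def)
      then have "snd z \<in> topspace E" using U by (auto simp: topspace_fibre_product)
      then show "y \<in> diagonal E" using z by (auto simp: diagonal_def)
    qed
    have "h (0, z) = z" for z using ends[of z] by (auto simp: h_def)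
    moreover have "h (t, z) = z" if "z \<in> diagonal E" "t \<in> {0..1}" for t z
      using sd[OF that(1)] that by (auto simp: h_def const_path_def diagonal_def)
    ultimately show "homotopic_with (\<lambda>f. \<forall>z\<in>diagonal E. f z = z) ?U ?Z id (\<lambda>z. h (1, z))"
      unfolding homotopic_with_def using hc by (intro exI[of _ h]) auto
  qed
qed

section \<open>Extending deformations to open sets\<close>

lemma abs_diff_INF_le:
  fixes F G :: "'b \<Rightarrow> real"
  assumes "A \<noteq> {}" "bdd_below (F ` A)" "bdd_below (G ` A)" and le: "\<And>b. b \<in> A \<Longrightarrow> \<bar>F b - G b\<bar> \<le> c"
  shows "\<bar>(INF b\<in>A. F b) - (INF b\<in>A. G b)\<bar> \<le> c"
proof -
  have 1: "(INF b\<in>A. F b) - c \<le> (INF b\<in>A. G b)"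
  proof (rule cINF_greatest[OF assms(1)])
    fix b assume b: "b \<in> A"
    show "(INF b\<in>A. F b) - c \<le> G b"
      using cINF_lower[OF assms(2) b] le[OF b] by linarith
  qed
  have 2: "(INF b\<in>A. G b) - c \<le> (INF b\<in>A. F b)"
  proof (rule cINF_greatest[OF assms(1)])
    fix b assume b: "b \<in> A"
    show "(INF b\<in>A. G b) - c \<le> F b"
      using cINF_lower[OF assms(3) b] le[OF b] by linarith
  qed
  from 1 2 show ?thesis by linarith
qed

text \<open>The approximation is the coordinatewise infimal convolution
  \<open>g x i = (INF b\<in>A. f b i + 4 * dist x b / \<eta> x)\<close> at the variable scale \<open>\<eta> x\<close>, which is at most the size of a
  ball on which \<open>f\<close> oscillates little. The positive function \<open>h\<close> is \<open>\<eta>\<close> itself.\<close>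

lemma approximate_extension_to_open:
  fixes f :: "'m::metric_space \<Rightarrow> 'k discrete \<Rightarrow>\<^sub>C real"
  assumes f: "continuous_on A f" and f01: "\<And>a i. a \<in> A \<Longrightarrow> f a i \<in> {0..1}"
    and \<epsilon>: "\<And>a. a \<in> A \<Longrightarrow> \<epsilon> a > 0"
  obtains V g h where "open V" "A \<subseteq> V"
    "continuous_on V g" "continuous_on V (h :: 'm \<Rightarrow> real)" "\<And>x. x \<in> V \<Longrightarrow> h x > 0"
    "\<And>x. x \<in> V \<Longrightarrow> \<exists>a\<in>A. dist x a < \<epsilon> a \<and> dist (g x) (f a) < \<epsilon> a \<and> h x < \<epsilon> a"
proof (cases "A = {}")
  case True
  show thesis by (rule that[of "{}" "\<lambda>_. 0" "\<lambda>_. 0"]) (auto simp: True)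
next
  case False
  \<comment> \<open>The bound 1 makes the supremum defining \<eta> finite;
    \<open>\<epsilon> a / 4\<close> and \<open>\<epsilon> a / 2\<close> are the shares of the error
    granted to distance and to oscillation.\<close>
  have "\<exists>r>0. r \<le> 1 \<and> r \<le> \<epsilon> a / 4 \<and> (\<forall>b\<in>A. dist b a < r \<longrightarrow> dist (f b) (f a) < \<epsilon> a / 2)"
    if a: "a \<in> A" for a
  proof -
    obtain r where r: "r > 0" "\<forall>b\<in>A. dist b a < r \<longrightarrow> dist (f b) (f a) < \<epsilon> a / 2"
      using f \<epsilon>[OF a] a unfolding continuous_on_iff by (metis half_gt_zero)
    then show ?thesis using \<epsilon>[OF a] by (intro exI[of _ "min r (min 1 (\<epsilon> a / 4))"]) auto
  qed
  then obtain \<delta> where \<delta>: "\<And>a. a \<in> A \<Longrightarrow> 0 < \<delta> a \<and> \<delta> a \<le> 1 \<and> \<delta> a \<le> \<epsilon> a / 4"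
    and \<delta>f: "\<And>a b. a \<in> A \<Longrightarrow> b \<in> A \<Longrightarrow> dist b a < \<delta> a \<Longrightarrow> dist (f b) (f a) < \<epsilon> a / 2"
    by metis
  \<comment> \<open>A 1-Lipschitz envelope of the radii, at least \<open>\<delta> a\<close> at
    \<open>a\<close>. If \<open>a\<close> attains more than half of the supremum at
    \<open>x\<close>, the ball of radius \<open>\<eta> x / 2\<close> about \<open>x\<close> lies in
    the ball of radius \<open>\<delta> a\<close> about \<open>a\<close>.\<close>
  define \<eta> where "\<eta> x = (SUP a\<in>A. \<delta> a - dist x a)" for x
  have le1: "\<delta> a - dist x a \<le> 1" if "a \<in> A" for a x using \<delta>[OF that] zero_le_dist[of x a] by linarith
  have bdd: "bdd_above ((\<lambda>a. \<delta> a - dist x a) ` A)" for x using le1 by (intro bdd_aboveI2)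
  have \<eta>ge: "\<delta> a - dist x a \<le> \<eta> x" if "a \<in> A" for a x
    unfolding \<eta>_def using bdd that by (intro cSUP_upper)
  have \<eta>1: "\<eta> x \<le> 1" for x unfolding \<eta>_def using False le1 by (intro cSUP_least) auto
  have \<eta>lip: "\<eta> x \<le> \<eta> y + dist x y" for x y
  proof -
    have "\<delta> a - dist x a \<le> \<eta> y + dist x y" if "a \<in> A" for a
      using \<eta>ge[OF that, of y] dist_triangle[of y a x] by (simp add: dist_commute)
    then show ?thesis using False unfolding \<eta>_def[of x] by (intro cSUP_least)
  qed
  have "dist (\<eta> x) (\<eta> y) \<le> dist x y" for x y
    using \<eta>lip[of x y] \<eta>lip[of y x] by (simp add: dist_real_def dist_commute)
  then have \<eta>c: "continuous_on UNIV \<eta>"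
    by (intro lipschitz_on_continuous_on[of 1] lipschitz_onI) auto
  \<comment> \<open>The quadratic bound provides a point \<open>b\<close> of \<open>A\<close> whose
    penalty \<open>4 * dist x b / \<eta> x\<close> is below \<open>\<eta> x / 8\<close>.\<close>
  define V where "V = {x. 0 < \<eta> x \<and> infdist x A < (\<eta> x)\<^sup>2 / 32}"
  have "open V" unfolding V_def
    by (intro open_Collect_conj open_Collect_less \<eta>c continuous_intros) auto
  moreover have "A \<subseteq> V"
  proof
    fix a assume "a \<in> A"
    then show "a \<in> V" using \<eta>ge[of a a] \<delta>[of a] by (simp add: V_def)
  qed
  moreover have \<eta>V: "0 < \<eta> x" if "x \<in> V" for x using that by (simp add: V_def)
  \<comment> \<open>Truncating the distance at 1 makes the estimate \<open>gdist\<close> uniform in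
    \<open>b\<close>. As \<open>\<eta> x \<le> 1\<close>, points at distance at least
    \<open>\<eta> x / 2\<close> still pay at least 2, too much to bring the infimum below values in
    \<open>{0..1}\<close>.\<close>
  define F where "F x i b = f b i + 4 * min 1 (dist x b) / \<eta> x" for x i b
  have F0: "0 \<le> F x i b" if "x \<in> V" "b \<in> A" for x i b
    using f01[OF that(2), of i] \<eta>V[OF that(1)] by (simp add: F_def)
  have Fbdd: "bdd_below (F x i ` A)" if "x \<in> V" for x i using F0[OF that] by (intro bdd_belowI2[of _ 0])
  define G where "G x i = (INF b\<in>A. F x i b)" for x i
  have G0: "0 \<le> G x i" if "x \<in> V" for x i unfolding G_def using False F0[OF that] by (intro cINF_greatest)
  have Gle: "G x i \<le> F x i b" if "x \<in> V" "b \<in> A" for x i b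
    unfolding G_def using Fbdd[OF that(1)] that(2) by (intro cINF_lower)
  define g where "g x = Bcontfun (G x)" for x
  have "G x \<in> bcontfun" if x: "x \<in> V" for x
  proof (rule bcontfun_normI)
    show "continuous_on UNIV (G x)"
      by (simp add: continuous_on_open_vimage open_discrete)
    obtain b where b: "b \<in> A" using False by blast
    have "F x i b \<le> 1 + 4 / \<eta> x" for i
      using f01[OF b, of i] \<eta>V[OF x] by (auto simp: F_def divide_right_mono intro!: add_mono)
    then show "norm (G x i) \<le> 1 + 4 / \<eta> x" for i
      using G0[OF x, of i] Gle[OF x b, of i] by (smt (verit) real_norm_def)
  qed
  then have ap: "apply_bcontfun (g x) i = G x i" if "x \<in> V" for x i
    unfolding g_def using that by (simp add: Bcontfun_inverse)
  \<comment> \<open>The bound involves neither \<open>b\<close> nor \<open>i\<close>, so it passes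
    through the infimum and the sup metric; it tends to 0 as \<open>y\<close> approaches
    \<open>x\<close>.\<close>
  have gdist: "dist (g y) (g x) \<le> 4 * (dist y x / \<eta> x + \<bar>1 / \<eta> y - 1 / \<eta> x\<bar>)" if "x \<in> V" "y \<in> V" for x y
  proof (rule dist_bound)
    fix i
    have "\<bar>F y i b - F x i b\<bar> \<le> 4 * (dist y x / \<eta> x + \<bar>1 / \<eta> y - 1 / \<eta> x\<bar>)" for b
    proof -
      let ?u = "min 1 (dist y b)" and ?v = "min 1 (dist x b)"
      have uv: "\<bar>?u - ?v\<bar> \<le> dist y x"
        using dist_triangle[of y b x] dist_triangle[of x b y] by (auto simp: dist_commute min_def)
      have "?u / \<eta> y - ?v / \<eta> x = ?u * (1 / \<eta> y - 1 / \<eta> x) + (?u - ?v) / \<eta> x"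
        by (simp add: algebra_simps diff_divide_distrib)
      also have "\<bar>\<dots>\<bar> \<le> \<bar>?u * (1 / \<eta> y - 1 / \<eta> x)\<bar> + \<bar>(?u - ?v) / \<eta> x\<bar>" by (rule abs_triangle_ineq)
      also have "\<bar>?u * (1 / \<eta> y - 1 / \<eta> x)\<bar> \<le> \<bar>1 / \<eta> y - 1 / \<eta> x\<bar>"
        by (simp add: abs_mult mult_left_le_one_le)
      also have "\<bar>(?u - ?v) / \<eta> x\<bar> \<le> dist y x / \<eta> x"
        using uv \<eta>V[OF that(1)] by (simp add: divide_right_mono)
      finally have "\<bar>?u / \<eta> y - ?v / \<eta> x\<bar> \<le> dist y x / \<eta> x + \<bar>1 / \<eta> y - 1 / \<eta> x\<bar>" by simp
      moreover have "F y i b - F x i b = 4 * (?u / \<eta> y - ?v / \<eta> x)" by (simp add: F_def)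
      ultimately show ?thesis
        by (simp only: abs_mult abs_numeral mult_le_cancel_left_pos zero_less_numeral)
    qed
    then show "dist (g y i) (g x i) \<le> 4 * (dist y x / \<eta> x + \<bar>1 / \<eta> y - 1 / \<eta> x\<bar>)"
      unfolding ap[OF that(1)] ap[OF that(2)] G_def dist_real_def
      using False Fbdd that by (intro abs_diff_INF_le)
  qed
  have "continuous_on V g"
    unfolding continuous_on_def
  proof
    fix x assume x: "x \<in> V"
    have \<eta>t: "(\<eta> \<longlongrightarrow> \<eta> x) (at x within V)"
      using \<eta>c continuous_on_subset[of UNIV \<eta> V] x unfolding continuous_on_def by auto
    have "((\<lambda>y. 4 * (dist y x / \<eta> x + \<bar>1 / \<eta> y - 1 / \<eta> x\<bar>)) \<longlongrightarrow> 4 * (dist x x / \<eta> x + \<bar>1 / \<eta> x - 1 / \<eta> x\<bar>)) (at x within V)"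
      using \<eta>V[OF x] by (intro tendsto_intros \<eta>t) auto
    then have "((\<lambda>y. 4 * (dist y x / \<eta> x + \<bar>1 / \<eta> y - 1 / \<eta> x\<bar>)) \<longlongrightarrow> 0) (at x within V)" by simp
    then have "((\<lambda>y. dist (g y) (g x)) \<longlongrightarrow> 0) (at x within V)"
    proof (rule Lim_null_comparison[rotated])
      show "\<forall>\<^sub>F y in at x within V. norm (dist (g y) (g x)) \<le> 4 * (dist y x / \<eta> x + \<bar>1 / \<eta> y - 1 / \<eta> x\<bar>)"
        unfolding eventually_at_filter
        by (intro always_eventually allI impI)
           (simp only: real_norm_def abs_of_nonneg[OF zero_le_dist] gdist[OF x])
    qed
    then show "(g \<longlongrightarrow> g x) (at x within V)" by (rule iffD2[OF tendsto_dist_iff])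
  qed
  moreover have "continuous_on V \<eta>" using \<eta>c continuous_on_subset by blast
  moreover have "\<exists>a\<in>A. dist x a < \<epsilon> a \<and> dist (g x) (f a) < \<epsilon> a \<and> \<eta> x < \<epsilon> a" if x: "x \<in> V" for x
  proof -
    have "\<eta> x / 2 < \<eta> x" using \<eta>V[OF x] by simp
    then obtain a where a: "a \<in> A" "\<eta> x / 2 < \<delta> a - dist x a"
      unfolding \<eta>_def[of x] using less_cSUP_iff[OF False bdd] by auto
    obtain b0 where b0: "b0 \<in> A" "dist x b0 < (\<eta> x)\<^sup>2 / 32"
    proof -
      have "bdd_below (dist x ` A)" by (intro bdd_belowI2[of _ 0]) simp
      moreover have "(INF b\<in>A. dist x b) < (\<eta> x)\<^sup>2 / 32"
        using x False by (simp add: V_def infdist_notempty)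
      ultimately show thesis using that cINF_less_iff[OF False] by blast
    qed
    have close: "\<bar>f b i - f a i\<bar> < \<epsilon> a / 2" if "b \<in> A" "dist x b < \<eta> x / 2" for b i
    proof -
      have "dist b a < \<delta> a" using dist_triangle[of b a x] that a by (simp add: dist_commute)
      from dist_fun_lt_imp_dist_val_lt[OF \<delta>f[OF a(1) that(1) this]] show ?thesis
        by (simp add: dist_real_def)
    qed
    have sq: "(\<eta> x)\<^sup>2 \<le> \<eta> x" using \<eta>1[of x] \<eta>V[OF x] by (simp add: power2_eq_square mult_left_le)
    \<comment> \<open>Here \<open>9/16 = 1/2 + 1/16\<close>: oscillation costs
      \<open>\<epsilon> a / 2\<close>, and the penalty of \<open>b0\<close> is at most
      \<open>\<eta> x / 8 < \<epsilon> a / 16\<close>, because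
      \<open>\<eta> x / 2 < \<delta> a \<le> \<epsilon> a / 4\<close>.\<close>
    have "\<bar>G x i - f a i\<bar> \<le> 9/16 * \<epsilon> a" for i
    proof -
      have "G x i \<le> f b0 i + 4 * min 1 (dist x b0) / \<eta> x" using Gle[OF x b0(1), of i] by (simp add: F_def)
      also have "4 * min 1 (dist x b0) / \<eta> x \<le> \<eta> x / 8"
        using b0(2) \<eta>V[OF x] by (simp add: field_simps power2_eq_square min_def)
      finally have 1: "G x i \<le> f a i + 9/16 * \<epsilon> a"
        using close[OF b0(1), of i] b0(2) sq a(2) \<delta>[OF a(1)] \<eta>V[OF x] zero_le_dist[of x a] by linarith
      have "f a i - \<epsilon> a / 2 \<le> F x i b" if b: "b \<in> A" for b
      proof (cases "dist x b < \<eta> x / 2")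
        case True
        have "0 \<le> 4 * min 1 (dist x b) / \<eta> x" using \<eta>V[OF x] by simp
        then show ?thesis using close[OF b True, of i] unfolding F_def by linarith
      next
        case False
        then have "2 \<le> 4 * min 1 (dist x b) / \<eta> x"
          using \<eta>V[OF x] \<eta>1[of x] by (simp add: field_simps min_def)
        then show ?thesis using f01[OF b, of i] f01[OF a(1), of i] \<epsilon>[OF a(1)] unfolding F_def by simp
      qed
      then have "f a i - \<epsilon> a / 2 \<le> G x i" unfolding G_def using False by (intro cINF_greatest)
      with 1 show ?thesis using \<epsilon>[OF a(1)] by linarith
    qed
    then have "dist (g x) (f a) \<le> 9/16 * \<epsilon> a"
      by (intro dist_bound) (simp add: ap[OF x] dist_real_def)
    then show ?thesis
      using a \<delta>[OF a(1)] \<eta>V[OF x] \<epsilon>[OF a(1)] zero_le_dist[of x a] by (intro bexI[of _ a] conjI) linarith+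
  qed
  ultimately show thesis using that \<eta>V by blast
qed

text \<open>Compactness of the interval keeps the condition open although it is imposed at all times
  at once.\<close>

lemma openin_Collect_ball_unit_interval:
  assumes "openin (prod_topology X (top_of_set {0..1::real})) S"
  shows "openin X {x \<in> topspace X. \<forall>t\<in>{0..1}. (x, t) \<in> S}"
proof (subst openin_subopen, intro ballI)
  fix x assume x: "x \<in> {x \<in> topspace X. \<forall>t\<in>{0..1}. (x, t) \<in> S}"
  then have "{x} \<times> {0..1} \<subseteq> S" "x \<in> topspace X" by auto
  moreover have "compactin (top_of_set {0..1::real}) {0..1}" by (simp add: compactin_subtopology)
  ultimately obtain U T where U: "openin X U" "x \<in> U" "{0..1} \<subseteq> T" "U \<times> T \<subseteq> S"
    using tube_lemma_right[OF assms] by meson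
  then have "U \<subseteq> {x \<in> topspace X. \<forall>t\<in>{0..1}. (x, t) \<in> S}"
    using openin_subset[OF U(1)] by blast
  then show "\<exists>T. openin X T \<and> x \<in> T \<and> T \<subseteq> {x \<in> topspace X. \<forall>t\<in>{0..1}. (x, t) \<in> S}"
    using U by blast
qed

lemma openin_Collect_ball_unit_interval':
  assumes F: "continuous_on (T \<times> {0..1::real}) F" "F ` (T \<times> {0..1}) \<subseteq> Y" and Q: "openin (top_of_set Y) Q"
  shows "openin (top_of_set T) {x \<in> T. \<forall>t\<in>{0..1}. F (x, t) \<in> Q}"
proof -
  have "openin (top_of_set (T \<times> {0..1})) ((T \<times> {0..1}) \<inter> F -` Q)"
    using F Q by (simp add: continuous_openin_preimage image_subset_iff_funcset)
  then have "openin (prod_topology (top_of_set T) (top_of_set {0..1})) ((T \<times> {0..1}) \<inter> F -` Q)"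
    by (simp add: prod_topology_subtopology_eu)
  from openin_Collect_ball_unit_interval[OF this] show ?thesis
    by (rule back_subst[of "openin (top_of_set T)"]) auto
qed

section \<open>Straight-line deformations in the collar\<close>

lemma dist_Pair_le: "dist (a, b) (c, d) \<le> dist a c + dist b d"
  by (simp add: dist_Pair_Pair sqrt_sum_squares_le_sum)

lemma dist_convex_combination_less:
  fixes a b m :: "'v::real_normed_vector"
  assumes "dist a m < c" "dist b m < c" "t \<in> {0..1}"
  shows "dist ((1 - t) *\<^sub>R a + t *\<^sub>R b) m < c"
  using convexD[OF convex_ball, of a m c b "1 - t" t] assms by (simp add: dist_commute)

text \<open>The space \<open>M \<times> {0} \<union> L \<times> (0, \<infinity>)\<close> contains \<open>M\<close> as a closed subset, whether or not \<open>M\<close> is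
  closed in \<open>L\<close>; positive height makes room for straight-line homotopies.\<close>

definition open_collar :: "'l set \<Rightarrow> ('l \<times> real) set"
  where "open_collar M = M \<times> {0} \<union> UNIV \<times> {0<..}"

text \<open>The segment from \<open>x\<close> to \<open>r x\<close> need not lie in
  \<open>M\<close>, so it is raised to positive height in the collar and pushed back by \<rho>.
  \<open>W\<close> consists of the points whose whole raised segment stays in
  \<open>Q\<close>.\<close>

lemma neighbourhood_deformation:
  fixes M :: "('l::real_normed_vector) set"
  assumes \<Delta>: "\<Delta> \<subseteq> M"
    and Q: "openin (top_of_set (open_collar M)) Q" "M \<times> {0} \<subseteq> Q"
    and \<rho>: "continuous_on Q \<rho>" "\<rho> ` Q \<subseteq> M" "\<And>m. m \<in> M \<Longrightarrow> \<rho> (m, 0) = m"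
    and N: "openin (top_of_set M) N" "\<Delta> \<subseteq> N"
    and r: "continuous_on N r" "r ` N \<subseteq> \<Delta>" "\<And>d. d \<in> \<Delta> \<Longrightarrow> r d = d"
  obtains W where "openin (top_of_set M) W" "\<Delta> \<subseteq> W" "W \<subseteq> N"
    "homotopic_with_canon (\<lambda>f. \<forall>d\<in>\<Delta>. f d = d) W M id r"
proof -
  \<comment> \<open>The height is positive except at the two ends and where \<open>r x = x\<close>;
    in these cases the point of the segment belongs to \<open>M\<close>.\<close>
  define s where "s = (\<lambda>(x, t). ((1 - t) *\<^sub>R x + t *\<^sub>R r x, t * (1 - t) * dist x (r x)))"
  have NM: "N \<subseteq> M" using N(1) openin_imp_subset by blast
  have rt: "continuous_on (N \<times> {0..1::real}) (\<lambda>z. r (fst z))"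
    by (rule continuous_on_compose2[OF r(1)]) (auto intro: continuous_intros)
  have s: "continuous_on (N \<times> {0..1}) s"
    unfolding s_def case_prod_unfold by (intro continuous_intros rt)
  have sY: "s ` (N \<times> {0..1}) \<subseteq> open_collar M"
  proof
    fix y assume "y \<in> s ` (N \<times> {0..1})"
    then obtain x t where xt: "x \<in> N" "t \<in> {0..1}" "y = s (x, t)" by auto
    have "r x \<in> M" "x \<in> M" using xt NM r(2) \<Delta> by auto
    moreover have "s (x, t) = (x, 0) \<or> s (x, t) = (r x, 0) \<or> snd (s (x, t)) > 0"
    proof (cases "t = 0 \<or> t = 1 \<or> x = r x")
      case True
      then show ?thesis by (auto simp: s_def algebra_simps)
    next
      case False
      then show ?thesis using xt by (auto simp: s_def)
    qed
    ultimately show "y \<in> open_collar M" unfolding xt open_collar_def by (auto simp: mem_Times_iff)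
  qed
  define W where "W = {x \<in> N. \<forall>t\<in>{0..1}. s (x, t) \<in> Q}"
  have "openin (top_of_set N) W"
    unfolding W_def by (rule openin_Collect_ball_unit_interval'[OF s sY Q(1)])
  then have W: "openin (top_of_set M) W" using N(1) openin_trans by blast
  have WN: "W \<subseteq> N" by (auto simp: W_def)
  have sd: "s (d, t) = (d, 0)" if "d \<in> \<Delta>" for d t
    using r(3)[OF that] by (simp add: s_def algebra_simps)
  have \<Delta>W: "\<Delta> \<subseteq> W" using sd Q(2) N(2) \<Delta> by (auto simp: W_def subset_iff)
  have hc: "continuous_on ({0..1} \<times> W) (\<lambda>(t, x). \<rho> (s (x, t)))"
    unfolding case_prod_unfold
    by (rule continuous_on_compose2[OF \<rho>(1) continuous_on_compose2[OF s]])
       (auto intro!: continuous_intros simp: W_def)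
  have hM: "(\<lambda>(t, x). \<rho> (s (x, t))) ` ({0..1} \<times> W) \<subseteq> M"
    using \<rho>(2) by (auto simp: W_def)
  have 0: "\<rho> (s (x, 0)) = x" "\<rho> (s (x, 1)) = r x" if "x \<in> W" for x
    using that \<rho>(3) NM WN r(2) \<Delta> by (auto simp: s_def subset_iff image_subset_iff)
  have "homotopic_with_canon (\<lambda>f. \<forall>d\<in>\<Delta>. f d = d) W M id r"
  proof (subst homotopic_with)
    show "\<And>h k. (\<And>x. x \<in> topspace (top_of_set W) \<Longrightarrow> h x = k x)
        \<Longrightarrow> (\<forall>d\<in>\<Delta>. h d = d) = (\<forall>d\<in>\<Delta>. k d = d)"
      by (intro ball_cong refl) (simp add: subsetD[OF \<Delta>W])
    show "\<exists>h. continuous_map (prod_topology (top_of_set {0..1::real}) (top_of_set W)) (top_of_set M) h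
       \<and> (\<forall>x\<in>topspace (top_of_set W). h (0, x) = id x) \<and> (\<forall>x\<in>topspace (top_of_set W). h (1, x) = r x)
       \<and> (\<forall>t\<in>{0..1}. \<forall>d\<in>\<Delta>. h (t, d) = d)"
      using hc hM 0 sd \<rho>(3) \<Delta>
      by (intro exI[of _ "\<lambda>(t, x). \<rho> (s (x, t))"])
         (auto simp: prod_topology_subtopology_eu image_subset_iff_funcset)
  qed
  then show thesis using that W \<Delta>W WN by blast
qed

text \<open>Three homotopies relative to \<Delta> are joined: a straight line from the identity to
  \<open>a 0\<close>, the approximated deformation from \<open>a 0\<close> to \<open>a 1\<close>,
  and, as \<open>a 1\<close> sends \<open>V\<close> into \<open>W\<close>, the deformation of
  \<open>W\<close> to \<open>r\<close>. The first two run in the collar and return to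
  \<open>M\<close> by \<rho>.\<close>

lemma extend_deformation_to_open:
  fixes M :: "('k discrete \<Rightarrow>\<^sub>C real) set"
  assumes M01: "\<And>m i. m \<in> M \<Longrightarrow> m i \<in> {0..1}"
    and \<Delta>: "closedin (top_of_set M) \<Delta>"
    and Q: "openin (top_of_set (open_collar M)) Q" "M \<times> {0} \<subseteq> Q"
    and \<rho>: "continuous_on Q \<rho>" "\<rho> ` Q \<subseteq> M" "\<And>m. m \<in> M \<Longrightarrow> \<rho> (m, 0) = m"
    and N: "openin (top_of_set M) N" "\<Delta> \<subseteq> N"
    and r: "continuous_on N r" "r ` N \<subseteq> \<Delta>" "\<And>d. d \<in> \<Delta> \<Longrightarrow> r d = d"
    and U: "\<Delta> \<subseteq> U" "U \<subseteq> M"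
    and hom: "homotopic_with_canon (\<lambda>f. \<forall>d\<in>\<Delta>. f d = d) U M id u" and u: "u ` U \<subseteq> \<Delta>"
  obtains V v where "openin (top_of_set M) V" "U \<subseteq> V" "v ` V \<subseteq> \<Delta>"
    "homotopic_with_canon (\<lambda>f. \<forall>d\<in>\<Delta>. f d = d) V M id v"
proof (cases "\<Delta> = {}")
  \<comment> \<open>With \<Delta> empty the image of \<open>u\<close> is empty, hence so is
    \<open>U\<close>. Otherwise distances to \<Delta> are meaningful, as needed for the height
    \<open>q\<close> below.\<close>
  case True
  show thesis
    by (rule that[of "{}" id]) (use True u in \<open>auto simp: homotopic_with_canon_on_empty\<close>)
next
  case False
  have \<Delta>M: "\<Delta> \<subseteq> M" using U by blast
  obtain W where W: "openin (top_of_set M) W" "\<Delta> \<subseteq> W" "W \<subseteq> N"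
    and homW: "homotopic_with_canon (\<lambda>f. \<forall>d\<in>\<Delta>. f d = d) W M id r"
    by (rule neighbourhood_deformation[OF \<Delta>M Q \<rho> N r])
  have OW: "openin (top_of_set (open_collar M)) (Q \<inter> \<rho> -` W)"
    using \<rho> W(1) Q(1) by (intro openin_trans[OF _ Q(1)] continuous_openin_preimage[of Q \<rho> M]) auto
  \<comment> \<open>A safety radius: collar points this close to \<open>(m, 0)\<close> lie in the
    domain of \<rho> and, for \<open>m\<close> in \<Delta>, are sent into \<open>W\<close>. Later
    errors are fractions of it.\<close>
  have "\<exists>R>0. \<forall>y\<in>open_collar M. dist y (m, 0) < R \<longrightarrow> y \<in> Q \<and> (m \<in> \<Delta> \<longrightarrow> \<rho> y \<in> W)"
    if m: "m \<in> M" for m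
  proof -
    have m0: "(m, 0) \<in> Q" using m Q(2) by blast
    obtain R1 where R1: "R1 > 0" "\<forall>y\<in>open_collar M. dist y (m, 0) < R1 \<longrightarrow> y \<in> Q"
      using Q(1) m0 unfolding openin_euclidean_subtopology_iff by blast
    have "\<exists>R2>0. \<forall>y\<in>open_collar M. dist y (m, 0) < R2 \<longrightarrow> \<rho> y \<in> W" if "m \<in> \<Delta>"
    proof -
      have "(m, 0) \<in> Q \<inter> \<rho> -` W" using m0 \<rho>(3)[OF m] that W(2) by auto
      then show ?thesis using OW unfolding openin_euclidean_subtopology_iff by blast
    qed
    then obtain R2 where R2: "R2 > 0" "m \<in> \<Delta> \<Longrightarrow> \<forall>y\<in>open_collar M. dist y (m, 0) < R2 \<longrightarrow> \<rho> y \<in> W"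
      using zero_less_one by blast
    then show ?thesis using R1 by (intro exI[of _ "min R1 R2"]) auto
  qed
  then obtain R where R0: "\<And>m. m \<in> M \<Longrightarrow> R m > 0"
    and R: "\<And>m y. m \<in> M \<Longrightarrow> y \<in> open_collar M \<Longrightarrow> dist y (m, 0) < R m \<Longrightarrow> y \<in> Q \<and> (m \<in> \<Delta> \<longrightarrow> \<rho> y \<in> W)"
    by metis
  have RO: "(l, q) \<in> Q \<and> (m \<in> \<Delta> \<longrightarrow> \<rho> (l, q) \<in> W)"
    if "m \<in> M" "(l, q) \<in> open_collar M" "dist l m < R m / 2" "0 \<le> q" "q < R m / 2" for m l q
  proof -
    have "dist (l, q) (m, 0) < R m"
      using dist_Pair_le[of l q m 0] that by (simp add: dist_real_def)
    then show ?thesis using R that by blast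
  qed
  obtain k where k': "continuous_map (prod_topology (top_of_set {0..1::real}) (top_of_set U)) (top_of_set M) k"
    "\<forall>x. k (0, x) = id x" "\<forall>x. k (1, x) = u x" "\<forall>t\<in>{0..1}. \<forall>d\<in>\<Delta>. k (t, d) = d"
    using hom unfolding homotopic_with_def by blast
  then have k: "continuous_on ({0..1} \<times> U) k" and kM: "\<And>t z. t \<in> {0..1} \<Longrightarrow> z \<in> U \<Longrightarrow> k (t, z) \<in> M"
    and k0: "\<And>z. k (0, z) = z" and k1: "\<And>z. k (1, z) = u z"
    and kd: "\<And>t d. t \<in> {0..1} \<Longrightarrow> d \<in> \<Delta> \<Longrightarrow> k (t, d) = d"
    by (auto simp: prod_topology_subtopology_eu image_subset_iff_funcset Pi_iff)
  define f where "f = (\<lambda>(z, t). k (t, z))"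
  have f: "continuous_on (U \<times> {0..1}) f"
    unfolding f_def case_prod_unfold
    by (rule continuous_on_compose2[OF k]) (auto intro!: continuous_intros)
  have fM: "f a \<in> M" if "a \<in> U \<times> {0..1}" for a using kM that by (auto simp: f_def)

  \<comment> \<open>Since \<open>f (d, t) = d\<close> at all times, points near \<open>d\<close>
    stay near \<open>d\<close> throughout, so one centre \<open>d\<close> serves every time.\<close>
  have "\<exists>\<omega>>0. \<omega> \<le> R d / 4 \<and> (\<forall>z\<in>U. dist z d < \<omega> \<longrightarrow> (\<forall>t\<in>{0..1}. dist (f (z, t)) d < R d / 4))"
    if d: "d \<in> \<Delta>" for d
  proof -
    have "openin (top_of_set U) {z \<in> U. \<forall>t\<in>{0..1}. f (z, t) \<in> ball d (R d / 4)}"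
      by (rule openin_Collect_ball_unit_interval'[OF f, of UNIV]) auto
    moreover have "d \<in> {z \<in> U. \<forall>t\<in>{0..1}. f (z, t) \<in> ball d (R d / 4)}"
      using d U kd R0 \<Delta>M by (auto simp: f_def)
    ultimately obtain \<omega> where \<omega>: "\<omega> > 0" "\<forall>z\<in>U. dist z d < \<omega> \<longrightarrow> z \<in> {z \<in> U. \<forall>t\<in>{0..1}. f (z, t) \<in> ball d (R d / 4)}"
      unfolding openin_euclidean_subtopology_iff by blast
    then show ?thesis using R0[of d] d \<Delta>M
      by (intro exI[of _ "min \<omega> (R d / 4)"]) (auto simp: dist_commute)
  qed
  then obtain \<omega> where \<omega>0: "\<And>d. d \<in> \<Delta> \<Longrightarrow> 0 < \<omega> d \<and> \<omega> d \<le> R d / 4"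
    and \<omega>: "\<And>d z t. d \<in> \<Delta> \<Longrightarrow> z \<in> U \<Longrightarrow> dist z d < \<omega> d \<Longrightarrow> t \<in> {0..1} \<Longrightarrow> dist (f (z, t)) d < R d / 4"
    by metis
  define T where "T = M \<inter> (\<Union>d\<in>\<Delta>. ball d (\<omega> d))"
  have "closedin (top_of_set M) (M - T)"
    using openin_open_Int[of "\<Union>d\<in>\<Delta>. ball d (\<omega> d)" M] by (auto simp: T_def closedin_def double_diff)
  moreover have "disjnt \<Delta> (M - T)" using \<omega>0 \<Delta>M by (force simp: disjnt_def T_def)
  moreover have "normal_space (top_of_set M)"
    using metrizable_space_euclidean metrizable_space_subtopology metrizable_imp_normal_space by blast
  ultimately obtain \<mu>' where \<mu>': "continuous_map (top_of_set M) (top_of_set {-1..1::real}) \<mu>'"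
    "\<mu>' ` (M - T) \<subseteq> {-1}" "\<mu>' ` \<Delta> \<subseteq> {1}"
    using Urysohn_lemma[of "top_of_set M" "M - T" \<Delta> "-1" 1] \<Delta> by (auto simp: disjnt_sym)
  have \<mu>'c: "continuous_on M \<mu>'" using \<mu>'(1) by simp
  \<comment> \<open>Cutting a Urysohn function with values in \<open>{-1..1}\<close> at 0 makes
    \<mu> vanish near each point of \<open>M - T\<close>, not only at it; the choice of \<epsilon>
    uses this.\<close>
  define \<mu> where "\<mu> x = max 0 (\<mu>' x)" for x
  have \<mu>c: "continuous_on M \<mu>" unfolding \<mu>_def by (intro continuous_intros \<mu>'c)
  have \<mu>\<Delta>: "\<mu> d = 1" if "d \<in> \<Delta>" for d using \<mu>'(3) that by (auto simp: \<mu>_def)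
  have \<mu>01: "\<mu> x \<in> {0..1}" if "x \<in> M" for x
    using \<mu>'(1) that by (auto simp: \<mu>_def continuous_map_in_subtopology Pi_iff)

  text \<open>The bounds by \<open>snd a\<close> and \<open>1 - snd a\<close> force a point at time \<open>0\<close> or \<open>1\<close> to be approximated from the
    same time.\<close>
  have "\<exists>\<epsilon>>0. \<epsilon> \<le> R (f a) / 4 \<and> (snd a > 0 \<longrightarrow> \<epsilon> \<le> snd a) \<and> (snd a < 1 \<longrightarrow> \<epsilon> \<le> 1 - snd a) \<and>
      ((\<exists>d\<in>\<Delta>. dist (fst a) d + \<epsilon> \<le> \<omega> d \<and> \<epsilon> \<le> R d / 4) \<or> (\<forall>v\<in>M. dist v (fst a) < \<epsilon> \<longrightarrow> \<mu> v = 0))"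
    if a: "a \<in> U \<times> {0..1}" for a
  proof -
    obtain z t where zt: "a = (z, t)" "z \<in> U" "t \<in> {0..1}" using a by auto
    define \<epsilon>1 where "\<epsilon>1 = min (R (f a) / 4) (min (if t > 0 then t else 1) (if t < 1 then 1 - t else 1))"
    have \<epsilon>1: "\<epsilon>1 > 0" "\<epsilon>1 \<le> R (f a) / 4" "t > 0 \<Longrightarrow> \<epsilon>1 \<le> t" "t < 1 \<Longrightarrow> \<epsilon>1 \<le> 1 - t"
      using R0[OF fM[OF a]] by (auto simp: \<epsilon>1_def)
    have "\<exists>\<epsilon>>0. (\<exists>d\<in>\<Delta>. dist z d + \<epsilon> \<le> \<omega> d \<and> \<epsilon> \<le> R d / 4) \<or> (\<forall>v\<in>M. dist v z < \<epsilon> \<longrightarrow> \<mu> v = 0)"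
    proof (cases "z \<in> T")
      case True
      then obtain d where d: "d \<in> \<Delta>" "dist z d < \<omega> d" by (auto simp: T_def dist_commute)
      then show ?thesis using \<omega>0[OF d(1)]
        by (intro exI[of _ "min (\<omega> d - dist z d) (R d / 4)"] conjI disjI1 bexI[of _ d]) (auto simp: min_def)
    next
      case False
      then have z: "z \<in> M" "\<mu>' z = -1" using zt U \<mu>'(2) by auto
      then obtain \<epsilon> where "\<epsilon> > 0" "\<forall>v\<in>M. dist v z < \<epsilon> \<longrightarrow> dist (\<mu>' v) (\<mu>' z) < 1"
        using \<mu>'c unfolding continuous_on_iff by (metis zero_less_one)
      then show ?thesis using z by (intro exI[of _ \<epsilon>]) (auto simp: \<mu>_def dist_real_def)
    qed
    then obtain \<epsilon>2 where "\<epsilon>2 > 0"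
      "(\<exists>d\<in>\<Delta>. dist z d + \<epsilon>2 \<le> \<omega> d \<and> \<epsilon>2 \<le> R d / 4) \<or> (\<forall>v\<in>M. dist v z < \<epsilon>2 \<longrightarrow> \<mu> v = 0)" by blast
    then show ?thesis using \<epsilon>1 zt by (intro exI[of _ "min \<epsilon>1 \<epsilon>2"]) force
  qed
  then obtain \<epsilon> where \<epsilon>: "\<And>a. a \<in> U \<times> {0..1} \<Longrightarrow> \<epsilon> a > 0 \<and> \<epsilon> a \<le> R (f a) / 4 \<and> (snd a > 0 \<longrightarrow> \<epsilon> a \<le> snd a) \<and> (snd a < 1 \<longrightarrow> \<epsilon> a \<le> 1 - snd a)"
    and \<epsilon>': "\<And>a. a \<in> U \<times> {0..1} \<Longrightarrow> (\<exists>d\<in>\<Delta>. dist (fst a) d + \<epsilon> a \<le> \<omega> d \<and> \<epsilon> a \<le> R d / 4) \<or> (\<forall>v\<in>M. dist v (fst a) < \<epsilon> a \<longrightarrow> \<mu> v = 0)"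
    by metis
  obtain V0 g \<eta> where V0: "open V0" "U \<times> {0..1} \<subseteq> V0" and g: "continuous_on V0 g"
    and \<eta>: "continuous_on V0 (\<eta> :: _ \<Rightarrow> real)" "\<And>x. x \<in> V0 \<Longrightarrow> \<eta> x > 0"
    and approx: "\<And>x. x \<in> V0 \<Longrightarrow> \<exists>a\<in>U \<times> {0..1}. dist x a < \<epsilon> a \<and> dist (g x) (f a) < \<epsilon> a \<and> \<eta> x < \<epsilon> a"
    by (rule approximate_extension_to_open[OF f, of \<epsilon>]) (use fM M01 \<epsilon> in \<open>blast+\<close>)

  define V where "V = {v \<in> M. \<forall>t\<in>{0..1}. (v, t) \<in> V0}"
  have V: "openin (top_of_set M) V"
    unfolding V_def using openin_Collect_ball_unit_interval'[of M id UNIV V0] V0(1) by simp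
  have UV: "U \<subseteq> V" using V0(2) U(2) by (auto simp: V_def)
  have VM: "V \<subseteq> M" by (auto simp: V_def)
  have VV0: "V \<times> {0..1} \<subseteq> V0" by (auto simp: V_def)
  \<comment> \<open>\<mu> damps \<open>g\<close> to the identity on \<Delta>. The height
    \<open>q\<close> is 0 on \<Delta> and, \<Delta> being closed in \<open>M\<close>, positive
    elsewhere on \<open>V\<close>, so \<open>(G, q)\<close> stays in the collar even where
    \<open>G\<close> leaves \<open>M\<close>.\<close>
  define G where "G = (\<lambda>(v, t). (1 - \<mu> v) *\<^sub>R g (v, t) + \<mu> v *\<^sub>R v)"
  define q where "q = (\<lambda>(v, t). \<eta> (v, t) * min 1 (infdist v \<Delta>))"
  have \<mu>V: "continuous_on (V \<times> {0..1::real}) (\<lambda>x. \<mu> (fst x))"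
    by (rule continuous_on_compose2[OF \<mu>c]) (use VM in \<open>auto intro: continuous_intros\<close>)
  have Gc: "continuous_on (V \<times> {0..1}) G"
    unfolding G_def case_prod_unfold prod.collapse
    by (intro continuous_intros \<mu>V continuous_on_subset[OF g VV0])
  have qc: "continuous_on (V \<times> {0..1}) q"
    unfolding q_def case_prod_unfold prod.collapse
    by (intro continuous_intros continuous_on_subset[OF \<eta>(1) VV0])
  have \<eta>pos: "0 < \<eta> (v, t)" if "v \<in> V" "t \<in> {0..1}" for v t
    using \<eta>(2) that by (simp add: V_def)
  have q0: "0 \<le> q (v, t)" "q (v, t) \<le> \<eta> (v, t)" if "v \<in> V" "t \<in> {0..1}" for v t
    using \<eta>pos[OF that] infdist_nonneg[of v \<Delta>] by (simp_all add: q_def mult_left_le)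
  have G\<Delta>: "G (d, t) = d" "q (d, t) = 0" if "d \<in> \<Delta>" for d t
    using that by (auto simp: G_def q_def \<mu>\<Delta>)
  have qpos: "0 < q (v, t)" if "v \<in> V" "t \<in> {0..1}" "v \<notin> \<Delta>" for v t
  proof -
    obtain C where C: "closed C" "\<Delta> = M \<inter> C" using \<Delta> by (auto simp: closedin_closed)
    have "v \<notin> C" using C(2) that VM by auto
    then have "0 < infdist v C" using C False infdist_pos_not_in_closed[of C v] by auto
    also have "\<dots> \<le> infdist v \<Delta>" using C(2) False by (intro infdist_mono) auto
    finally show ?thesis using \<eta>pos[OF that(1,2)] by (simp add: q_def)
  qed
  \<comment> \<open>One centre \<open>m\<close> bounds everything. Near \<Delta> it is a point
    \<open>d\<close> of \<Delta>, close to both \<open>g (v, t)\<close> and \<open>v\<close>.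
    Elsewhere \<open>\<mu> v = 0\<close>, so \<open>G\<close> is \<open>g\<close> and
    \<open>m = f (z, s)\<close>; at the end times \<open>s = t\<close>, which makes \<open>m\<close>
    equal to \<open>z\<close> at time 0 and a point of \<Delta> at time 1.\<close>
  have key: "\<exists>m\<in>M. dist (G (v, t)) m < R m / 2 \<and> q (v, t) < R m / 2 \<and> (t = 1 \<longrightarrow> m \<in> \<Delta>) \<and> (t = 0 \<longrightarrow> dist v m < R m / 2)"
    if v: "v \<in> V" and t: "t \<in> {0..1}" for v t
  proof -
    have vM: "v \<in> M" using v VM by blast
    obtain z s where zs: "z \<in> U" "s \<in> {0..1}" and d: "dist (v, t) (z, s) < \<epsilon> (z, s)"
      and gz: "dist (g (v, t)) (f (z, s)) < \<epsilon> (z, s)" and "\<eta> (v, t) < \<epsilon> (z, s)"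
      using approx[of "(v, t)"] v t VV0 by blast
    with q0[OF v t] have qz: "q (v, t) < \<epsilon> (z, s)" by linarith
    have dz: "dist v z < \<epsilon> (z, s)" "\<bar>t - s\<bar> < \<epsilon> (z, s)"
      using d dist_fst_le[of "(v, t)" "(z, s)"] dist_snd_le[of "(v, t)" "(z, s)"] by (simp_all add: dist_real_def)
    have \<epsilon>z: "\<epsilon> (z, s) > 0" "\<epsilon> (z, s) \<le> R (f (z, s)) / 4" "s > 0 \<Longrightarrow> \<epsilon> (z, s) \<le> s" "s < 1 \<Longrightarrow> \<epsilon> (z, s) \<le> 1 - s"
      using \<epsilon>[of "(z, s)"] zs by auto
    from \<epsilon>'[of "(z, s)"] zs consider
      (1) d where "d \<in> \<Delta>" "dist z d + \<epsilon> (z, s) \<le> \<omega> d" "\<epsilon> (z, s) \<le> R d / 4" | (2) "\<mu> v = 0"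
      using vM dz(1) by auto
    then show ?thesis
    proof cases
      case 1
      have "dist z d < \<omega> d" using 1 \<epsilon>z by linarith
      then have "dist (f (z, s)) d < R d / 4" using \<omega>[OF 1(1) zs(1) _ zs(2)] by blast
      then have "dist (g (v, t)) d < R d / 2"
        using gz 1(3) dist_triangle[of "g (v, t)" d "f (z, s)"] by linarith
      moreover have vd: "dist v d < R d / 2"
        using dz(1) 1 \<omega>0[OF 1(1)] \<epsilon>z(1) dist_triangle[of v d z] by linarith
      ultimately have "dist (G (v, t)) d < R d / 2"
        using \<mu>01[OF vM] unfolding G_def prod.case by (intro dist_convex_combination_less)
      then show ?thesis
        using vd 1 \<Delta>M qz \<epsilon>z(1) by (intro bexI[of _ d]) (auto simp: dist_commute)
    next
      case 2
      have "t = 1 \<Longrightarrow> s = 1" "t = 0 \<Longrightarrow> s = 0" using \<epsilon>z(3,4) dz(2) zs(2) by force+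
      then have "t = 1 \<Longrightarrow> f (z, s) \<in> \<Delta>" "t = 0 \<Longrightarrow> f (z, s) = z"
        using u zs k0 k1 by (auto simp: f_def)
      then show ?thesis
        using gz qz dz(1) \<epsilon>z(1,2) 2 fM[of "(z, s)"] zs
        by (intro bexI[of _ "f (z, s)"]) (auto simp: G_def)
    qed
  qed
  have collar: "(G (v, t), q (v, t)) \<in> open_collar M" if "v \<in> V" "t \<in> {0..1}" for v t
    using qpos[OF that] G\<Delta>[of v t] that VM by (cases "v \<in> \<Delta>") (auto simp: open_collar_def)
  have GO: "(G (v, t), q (v, t)) \<in> Q" if vt: "v \<in> V" "t \<in> {0..1}" for v t
    using key[OF vt] RO collar[OF vt] q0[OF vt] by blast
  define a where "a t v = \<rho> (G (v, t), q (v, t))" for t v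
  have aW: "a 1 v \<in> W" if "v \<in> V" for v
    unfolding a_def using key[OF that, of 1] RO[OF _ collar[OF that, of 1]] q0[OF that, of 1] by auto
  have a\<Delta>: "a t d = d" if "d \<in> \<Delta>" for t d
    using G\<Delta>[OF that] \<rho>(3) that \<Delta>M by (auto simp: a_def)
  let ?P = "\<lambda>f. \<forall>d\<in>\<Delta>. f d = d"
  have Pcong: "\<And>h k. (\<And>x. x \<in> topspace (top_of_set V) \<Longrightarrow> h x = k x) \<Longrightarrow> ?P h = ?P k"
    by (intro ball_cong refl) (simp add: subsetD[OF UV] subsetD[OF U(1)])
  \<comment> \<open>At time 0 the same ball about \<open>m\<close> contains \<open>v\<close> and
    \<open>G (v, 0)\<close>, hence the segment between them; the height grows linearly from 0 to
    \<open>q (v, 0)\<close>.\<close>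
  have 1: "homotopic_with_canon ?P V M id (a 0)"
  proof (subst homotopic_with[OF Pcong])
    define b where "b = (\<lambda>(t, v). ((1 - t) *\<^sub>R v + t *\<^sub>R G (v, 0), t * q (v, 0)))"
    have G0: "continuous_on ({0..1::real} \<times> V) (\<lambda>x. G (snd x, 0))"
      by (rule continuous_on_compose2[OF Gc]) (auto intro!: continuous_intros)
    have q0': "continuous_on ({0..1::real} \<times> V) (\<lambda>x. q (snd x, 0))"
      by (rule continuous_on_compose2[OF qc]) (auto intro!: continuous_intros)
    have bc: "continuous_on ({0..1} \<times> V) b"
      unfolding b_def case_prod_unfold by (intro continuous_intros G0 q0')
    have b\<Delta>: "b (t, d) = (d, 0)" if "d \<in> \<Delta>" for t d
      using G\<Delta>[OF that] by (simp add: b_def algebra_simps)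
    have bO: "b (t, v) \<in> Q" if t: "t \<in> {0..1}" and v: "v \<in> V" for t v
    proof -
      obtain m where m: "m \<in> M" "dist (G (v, 0)) m < R m / 2" "q (v, 0) < R m / 2" "dist v m < R m / 2"
        using key[OF v, of 0] by auto
      have "dist ((1 - t) *\<^sub>R v + t *\<^sub>R G (v, 0)) m < R m / 2"
        using t m by (intro dist_convex_combination_less)
      moreover have "0 \<le> t * q (v, 0)" "t * q (v, 0) \<le> q (v, 0)"
        using t q0[OF v, of 0] by (auto simp: mult_left_le_one_le)
      moreover have "b (t, v) \<in> open_collar M"
      proof (cases "v \<in> \<Delta> \<or> t = 0")
        case True
        then have "b (t, v) = (v, 0)" using b\<Delta> by (auto simp: b_def)
        then show ?thesis using v VM by (auto simp: open_collar_def)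
      next
        case False
        then have "0 < snd (b (t, v))" using qpos[OF v, of 0] t by (simp add: b_def)
        then show ?thesis by (auto simp: open_collar_def mem_Times_iff)
      qed
      ultimately show ?thesis using RO[OF m(1)] m(3) unfolding b_def by fastforce
    qed
    have "continuous_on ({0..1} \<times> V) (\<lambda>x. \<rho> (b x))"
      by (rule continuous_on_compose2[OF \<rho>(1) bc]) (use bO in auto)
    moreover have "(\<lambda>x. \<rho> (b x)) ` ({0..1} \<times> V) \<subseteq> M" using bO \<rho>(2) by blast
    moreover have "\<rho> (b (0, v)) = v" "\<rho> (b (1, v)) = a 0 v" if "v \<in> V" for v
      using \<rho>(3) that VM by (auto simp: b_def a_def)
    moreover have "\<rho> (b (t, d)) = d" if "d \<in> \<Delta>" for t d
      using b\<Delta>[OF that] \<rho>(3) that \<Delta>M by auto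
    ultimately show "\<exists>h. continuous_map (prod_topology (top_of_set {0..1::real}) (top_of_set V)) (top_of_set M) h
       \<and> (\<forall>x\<in>topspace (top_of_set V). h (0, x) = id x) \<and> (\<forall>x\<in>topspace (top_of_set V). h (1, x) = a 0 x)
       \<and> (\<forall>t\<in>{0..1}. ?P (\<lambda>x. h (t, x)))"
      by (intro exI[of _ "\<lambda>x. \<rho> (b x)"]) (auto simp: prod_topology_subtopology_eu image_subset_iff_funcset)
  qed
  have 2: "homotopic_with_canon ?P V M (a 0) (a 1)"
    unfolding homotopic_with_def
  proof (intro exI[of _ "\<lambda>(t, v). a t v"] conjI allI ballI)
    have "continuous_on ({0..1::real} \<times> V) (\<lambda>x. (G (snd x, fst x), q (snd x, fst x)))"
      by (intro continuous_on_Pair continuous_on_compose2[OF Gc] continuous_on_compose2[OF qc])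
         (auto intro!: continuous_intros)
    then have "continuous_on ({0..1::real} \<times> V) (\<lambda>(t, v). a t v)"
      unfolding a_def case_prod_unfold
      by (rule continuous_on_compose2[OF \<rho>(1)]) (use GO in auto)
    moreover have "(\<lambda>(t, v). a t v) ` ({0..1} \<times> V) \<subseteq> M" using GO \<rho>(2) by (auto simp: a_def)
    ultimately show "continuous_map (prod_topology (top_of_set {0..1::real}) (top_of_set V)) (top_of_set M) (\<lambda>(t, v). a t v)"
      by (simp add: prod_topology_subtopology_eu image_subset_iff_funcset)
  qed (use a\<Delta> in auto)
  have "continuous_map (top_of_set V) (top_of_set M) (a 1)"
    using homotopic_with_imp_continuous_maps[OF 2] by blast
  then have "continuous_map (top_of_set V) (top_of_set W) (a 1)"
    using aW by (auto simp: continuous_map_in_subtopology)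
  from homotopic_with_compose_continuous_map_right[OF homW this, of ?P]
  have 3: "homotopic_with_canon ?P V M (a 1) (r \<circ> a 1)"
    using a\<Delta> by simp
  show thesis
  proof (rule that[OF V UV])
    show "(r \<circ> a 1) ` V \<subseteq> \<Delta>" using aW W(3) r(2) by auto
    show "homotopic_with_canon ?P V M id (r \<circ> a 1)"
      using 1 2 3 homotopic_with_trans by blast
  qed
qed

section \<open>Deformations in ANRs\<close>

text \<open>The ambient spaces in \<open>ANR_space\<close> are carried by
  \<open>'a \<Rightarrow> real\<close>. The injection \<open>J\<close> copies \<open>Y\<close> into
  that type; the retraction found there is pulled back along \<open>J\<close> and followed by the
  inverse of the embedding.\<close>

lemma ANR_space_neighbourhood_retraction:
  fixes X :: "'a topology" and Y :: "'c topology" and J :: "'c \<Rightarrow> 'a \<Rightarrow> real"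
  assumes X: "ANR_space X" and Y: "metrizable_space Y"
    and h: "embedding_map X Y h" "closedin Y (h ` topspace X)" and J: "inj J"
  obtains U r where "openin Y U" "h ` topspace X \<subseteq> U"
    "continuous_map (subtopology Y U) X r" "\<And>x. x \<in> topspace X \<Longrightarrow> r (h x) = x"
proof -
  define Y' where "Y' = pullback_topology (range J) (inv J) Y"
  have tY': "topspace Y' = J ` topspace Y"
    using J by (auto simp: Y'_def topspace_pullback_topology)
  have J1: "continuous_map Y Y' J"
    unfolding Y'_def using J by (intro continuous_map_pullback') (auto simp: o_def continuous_map_id[unfolded id_def])
  have J2: "continuous_map Y' Y (inv J)"
    unfolding Y'_def using continuous_map_pullback[OF continuous_map_id[of Y], of "range J" "inv J"]
    by simp
  have JJ: "homeomorphic_maps Y Y' J (inv J)"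
    using J1 J2 J tY' by (auto simp: homeomorphic_maps_def)
  have "metrizable_space Y'"
    using Y homeomorphic_metrizable_space JJ unfolding homeomorphic_space_def by blast
  moreover have Jh: "homeomorphic_map Y Y' J" using JJ homeomorphic_map_maps by blast
  then have "embedding_map Y Y' J"
    unfolding embedding_map_def by (simp flip: tY')
  then have Jh': "embedding_map X Y' (J \<circ> h)" using h(1) embedding_map_compose by blast
  moreover have "h ` topspace X \<subseteq> topspace Y" using h(2) closedin_subset by blast
  then have "closedin Y' ((J \<circ> h) ` topspace X)"
    using homeomorphic_map_closedness[OF Jh] h(2) by (metis image_comp)
  ultimately obtain U' r' where U': "openin Y' U'" "(J \<circ> h) ` topspace X \<subseteq> topspace (subtopology Y' U')"
    and r': "continuous_map (subtopology Y' U') (subtopology (subtopology Y' U') ((J \<circ> h) ` topspace X)) r'"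
      "\<forall>x\<in>(J \<circ> h) ` topspace X. r' x = x"
    using X unfolding ANR_space_def retract_of_space_def by metis
  obtain k where k: "homeomorphic_maps X (subtopology Y' ((J \<circ> h) ` topspace X)) (J \<circ> h) k"
    using Jh' unfolding embedding_map_def homeomorphic_map_maps by blast
  define U where "U = {y \<in> topspace Y. J y \<in> U'}"
  show thesis
  proof (rule that)
    show "openin Y U" unfolding U_def by (rule openin_continuous_map_preimage[OF J1 U'(1)])
    show "h ` topspace X \<subseteq> U" using U'(2) \<open>h ` topspace X \<subseteq> topspace Y\<close> by (auto simp: U_def)
    have "continuous_map (subtopology Y U) (subtopology Y' U') J"
      by (rule continuous_map_into_subtopology[OF continuous_map_from_subtopology[OF J1]]) (auto simp: U_def)
    moreover have "continuous_map (subtopology Y' U') (subtopology Y' ((J \<circ> h) ` topspace X)) r'"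
      using r'(1) by (auto simp: continuous_map_in_subtopology)
    moreover have "continuous_map (subtopology Y' ((J \<circ> h) ` topspace X)) X k"
      using k by (simp add: homeomorphic_maps_def)
    ultimately show "continuous_map (subtopology Y U) X (k \<circ> (r' \<circ> J))"
      by (intro continuous_map_compose)
    show "(k \<circ> (r' \<circ> J)) (h x) = x" if "x \<in> topspace X" for x
      using r'(2) k that by (auto simp: homeomorphic_maps_def)
  qed
qed

lemma homotopic_with_homeomorphic_maps:
  fixes X :: "'a topology" and Y :: "'b topology"
  assumes fg: "homeomorphic_maps X Y f g" and S: "D \<subseteq> S" "S \<subseteq> topspace X"
    and hom: "homotopic_with (\<lambda>h. \<forall>d\<in>D. h d = d) (subtopology X S) X id u"
  shows "homotopic_with (\<lambda>h. \<forall>d\<in>f ` D. h d = d) (subtopology Y (f ` S)) Y id (f \<circ> u \<circ> g)"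
proof -
  have gf: "g (f x) = x" if "x \<in> S" for x using fg that S(2) by (auto simp: homeomorphic_maps_def)
  have f: "continuous_map X Y f" and g: "continuous_map Y X g" using fg by (auto simp: homeomorphic_maps_def)
  have "continuous_map (subtopology Y (f ` S)) (subtopology X S) g"
    by (rule continuous_map_into_subtopology[OF continuous_map_from_subtopology[OF g]]) (auto simp: gf)
  \<comment> \<open>After precomposing with \<open>g\<close> the maps still end in \<open>X\<close>,
    so being fixed on \<open>D\<close> reads as agreeing with \<open>g\<close> on \<open>f\<close>
    applied to \<open>D\<close>.\<close>
  from homotopic_with_compose_continuous_map_right[OF hom this, of "\<lambda>h. \<forall>d\<in>f ` D. h d = g d"]
  have "homotopic_with (\<lambda>h. \<forall>d\<in>f ` D. h d = g d) (subtopology Y (f ` S)) X (id \<circ> g) (u \<circ> g)"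
    using gf S(1) by fastforce
  from homotopic_with_compose_continuous_map_left[OF this f, of "\<lambda>h. \<forall>d\<in>f ` D. h d = d"]
  have "homotopic_with (\<lambda>h. \<forall>d\<in>f ` D. h d = d) (subtopology Y (f ` S)) Y (f \<circ> (id \<circ> g)) (f \<circ> (u \<circ> g))"
    using gf S(1) by fastforce
  then show ?thesis
  proof (rule homotopic_with_eq)
    show "id x = (f \<circ> (id \<circ> g)) x" if "x \<in> topspace (subtopology Y (f ` S))" for x
      using gf that by auto
    fix h k :: "'b \<Rightarrow> 'b" assume "\<And>x. x \<in> topspace (subtopology Y (f ` S)) \<Longrightarrow> h x = k x"
    moreover have "f ` D \<subseteq> topspace (subtopology Y (f ` S))"
      using S continuous_map_image_subset_topspace[OF f] by auto
    ultimately show "(\<forall>d\<in>f ` D. h d = d) \<longleftrightarrow> (\<forall>d\<in>f ` D. k d = d)"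
      by (metis (no_types, lifting) subsetD)
  qed (simp add: o_assoc)
qed

text \<open>Serves to pack the height of a collar point into the values of its function, so that the
  collar can be coded in \<open>'a \<Rightarrow> real\<close>.\<close>

lemma ex_inj_real_pair: "\<exists>f :: real \<times> real \<Rightarrow> real. inj f"
proof -
  obtain f :: "real \<times> real \<Rightarrow> real" where "bij_betw f (UNIV \<times> UNIV) UNIV"
    using card_of_Times_same_infinite[of "UNIV :: real set"] infinite_UNIV_char_0 card_of_ordIso by blast
  then show ?thesis by (auto simp: bij_betw_def)
qed

text \<open>The Kuratowski embedding identifies \<open>X\<close> with \<open>M\<close>. At height 0,
  \<open>M\<close> is closed in the collar, so the ANR property supplies \<rho>. The deformation is
  conjugated to \<open>M\<close>, extended there and conjugated back.\<close>

lemma ANR_space_extend_deformation_to_open: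
  fixes X :: "'a topology"
  assumes X: "ANR_space X" and D: "closedin X D"
    and N: "openin X N" "D \<subseteq> N"
    and r: "continuous_map (subtopology X N) X r" "r ` N \<subseteq> D" "\<And>d. d \<in> D \<Longrightarrow> r d = d"
    and U: "D \<subseteq> U" "U \<subseteq> topspace X"
    and hom: "homotopic_with (\<lambda>f. \<forall>d\<in>D. f d = d) (subtopology X U) X id u" "u ` U \<subseteq> D"
  obtains V v where "openin X V" "U \<subseteq> V" "v ` V \<subseteq> D"
    "homotopic_with (\<lambda>f. \<forall>d\<in>D. f d = d) (subtopology X V) X id v"
proof -
  have metX: "metrizable_space X" using X ANR_space_def by blast
  obtain \<kappa> :: "'a \<Rightarrow> 'a discrete \<Rightarrow>\<^sub>C real" where \<kappa>: "homeomorphic_map X (top_of_set (\<kappa> ` topspace X)) \<kappa>"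
    and \<kappa>01: "\<And>x i. \<kappa> x i \<in> {0..1}"
    using kuratowski_embedding[OF metX] by metis
  define M where "M = \<kappa> ` topspace X"
  obtain l where \<kappa>l: "homeomorphic_maps X (top_of_set M) \<kappa> l"
    using \<kappa> unfolding M_def homeomorphic_map_maps by blast
  have \<kappa>M: "homeomorphic_map X (top_of_set M) \<kappa>" and lh: "homeomorphic_map (top_of_set M) X l"
    using \<kappa>l homeomorphic_maps_map by blast+
  have \<kappa>c: "continuous_map X (top_of_set M) \<kappa>" and lc: "continuous_map (top_of_set M) X l"
    and l\<kappa>: "\<And>x. x \<in> topspace X \<Longrightarrow> l (\<kappa> x) = x" and \<kappa>l': "\<And>m. m \<in> M \<Longrightarrow> \<kappa> (l m) = m"
    and lM: "\<And>m. m \<in> M \<Longrightarrow> l m \<in> topspace X"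
    using \<kappa>l by (auto simp: homeomorphic_maps_def continuous_map_def)
  let ?Y = "top_of_set (open_collar M)"
  have "homeomorphic_maps (top_of_set M) (top_of_set (M \<times> {0::real})) (\<lambda>m. (m, 0)) fst"
    unfolding homeomorphic_maps_def by (auto intro!: continuous_intros simp: continuous_on_fst)
  then have "homeomorphic_map (top_of_set M) (top_of_set (M \<times> {0::real})) (\<lambda>m. (m, 0))"
    using homeomorphic_map_maps by blast
  from homeomorphic_map_compose[OF \<kappa>M this]
  have "homeomorphic_map X (top_of_set (M \<times> {0::real})) (\<lambda>x. (\<kappa> x, 0))" by (simp add: o_def)
  moreover have im: "(\<lambda>x. (\<kappa> x, 0::real)) ` topspace X = M \<times> {0}" by (auto simp: M_def)
  moreover have "M \<times> {0} \<subseteq> open_collar M" by (auto simp: open_collar_def)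
  ultimately have emb: "embedding_map X ?Y (\<lambda>x. (\<kappa> x, 0))"
    by (simp add: embedding_map_def subtopology_subtopology Int_absorb1)
  have "M \<times> {0} = open_collar M \<inter> {y. snd y = 0}" by (auto simp: open_collar_def)
  moreover have "closed {y :: ('a discrete \<Rightarrow>\<^sub>C real) \<times> real. snd y = 0}"
    by (intro closed_Collect_eq continuous_intros)
  ultimately have "closedin ?Y ((\<lambda>x. (\<kappa> x, 0)) ` topspace X)"
    unfolding im by (metis closedin_closed_Int)
  moreover obtain pr :: "real \<times> real \<Rightarrow> real" where pr: "inj pr" using ex_inj_real_pair by blast
  \<comment> \<open>Every coordinate also records the height; as types are nonempty, some coordinate
    exists from which to recover it.\<close>
  have "inj (\<lambda>(b :: 'a discrete \<Rightarrow>\<^sub>C real, t) i. pr (b (discrete i), t))"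
  proof (rule injI)
    fix y y' :: "('a discrete \<Rightarrow>\<^sub>C real) \<times> real"
    assume eq: "(\<lambda>(b, t) i. pr (apply_bcontfun b (discrete i), t)) y = (\<lambda>(b, t) i. pr (apply_bcontfun b (discrete i), t)) y'"
    have "pr (fst y (discrete i), snd y) = pr (fst y' (discrete i), snd y')" for i
      using fun_cong[OF eq, of i] by (simp add: case_prod_unfold)
    then have *: "fst y (discrete i) = fst y' (discrete i) \<and> snd y = snd y'" for i
      using pr by (auto dest: injD)
    have "fst y j = fst y' j" for j using *[of "of_discrete j"] by (simp add: of_discrete_inverse)
    then show "y = y'" using * by (auto intro!: prod_eqI bcontfun_eqI)
  qed
  moreover have "metrizable_space ?Y"
    using metrizable_space_euclidean metrizable_space_subtopology by blast
  ultimately obtain Q \<rho> where Q: "openin ?Y Q" "M \<times> {0} \<subseteq> Q"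
    and \<rho>: "continuous_map (subtopology ?Y Q) X \<rho>" "\<And>x. x \<in> topspace X \<Longrightarrow> \<rho> (\<kappa> x, 0) = x"
    using ANR_space_neighbourhood_retraction[OF X _ emb] im by metis
  have QY: "Q \<subseteq> open_collar M" using Q(1) openin_imp_subset by blast
  then have \<rho>c: "continuous_map (top_of_set Q) X \<rho>"
    using \<rho>(1) by (simp add: subtopology_subtopology Int_absorb1)
  have "continuous_map (top_of_set Q) (top_of_set M) (\<lambda>y. \<kappa> (\<rho> y))"
    by (rule continuous_map_compose'[OF \<kappa>c \<rho>c])
  then have \<rho>': "continuous_on Q (\<lambda>y. \<kappa> (\<rho> y))" "(\<lambda>y. \<kappa> (\<rho> y)) ` Q \<subseteq> M"
    by (auto simp: Pi_iff)
  have \<rho>0: "\<kappa> (\<rho> (m, 0)) = m" if "m \<in> M" for m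
    using \<rho>(2) that by (auto simp: M_def)
  have sub: "D \<subseteq> topspace X" "N \<subseteq> topspace X" "r ` N \<subseteq> topspace X"
    using D N r(2) closedin_subset openin_subset by blast+
  have cl: "closedin (top_of_set M) (\<kappa> ` D)"
    using homeomorphic_map_closedness[OF \<kappa>M sub(1)] D by simp
  have op: "openin (top_of_set M) (\<kappa> ` N)"
    using homeomorphic_map_openness[OF \<kappa>M sub(2)] N by simp
  have "continuous_map (top_of_set (\<kappa> ` N)) (subtopology X N) l"
  proof (rule continuous_map_into_subtopology)
    show "continuous_map (top_of_set (\<kappa> ` N)) X l"
      using continuous_map_from_subtopology_mono[OF lc, of "\<kappa> ` N"] sub(2) by (auto simp: M_def)
  qed (use l\<kappa> sub(2) in auto)
  from continuous_map_compose'[OF \<kappa>c continuous_map_compose'[OF r(1) this]]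
  have r': "continuous_on (\<kappa> ` N) (\<lambda>m. \<kappa> (r (l m)))" by simp
  have l\<kappa>': "\<And>A x. A \<subseteq> topspace X \<Longrightarrow> x \<in> A \<Longrightarrow> l (\<kappa> x) = x" using l\<kappa> by blast
  have hom': "homotopic_with_canon (\<lambda>f. \<forall>d\<in>\<kappa> ` D. f d = d) (\<kappa> ` U) M id (\<kappa> \<circ> u \<circ> l)"
    using homotopic_with_homeomorphic_maps[OF \<kappa>l U hom(1)] U(2)
    by (simp add: subtopology_subtopology M_def Int_absorb1 image_mono)
  obtain V v where V: "openin (top_of_set M) V" "\<kappa> ` U \<subseteq> V" "v ` V \<subseteq> \<kappa> ` D"
    and homV: "homotopic_with_canon (\<lambda>f. \<forall>d\<in>\<kappa> ` D. f d = d) V M id v"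
  proof (rule extend_deformation_to_open[OF _ cl Q \<rho>' \<rho>0 op _ r' _ _ _ _ hom'])
    show "m i \<in> {0..1}" if "m \<in> M" for m i using \<kappa>01 that by (auto simp: M_def)
    show "\<kappa> ` D \<subseteq> \<kappa> ` N" "\<kappa> ` D \<subseteq> \<kappa> ` U" "\<kappa> ` U \<subseteq> M" using N U by (auto simp: M_def)
    show "(\<lambda>m. \<kappa> (r (l m))) ` \<kappa> ` N \<subseteq> \<kappa> ` D" using r(2) l\<kappa>'[OF sub(2)] by auto
    show "\<kappa> (r (l d)) = d" if "d \<in> \<kappa> ` D" for d using r(3) l\<kappa>'[OF sub(1)] that by auto
    show "(\<kappa> \<circ> u \<circ> l) ` \<kappa> ` U \<subseteq> \<kappa> ` D" using hom(2) l\<kappa>'[OF U(2)] by auto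
  qed blast
  have VM: "V \<subseteq> M" using V(1) openin_imp_subset by blast
  have inv: "l ` \<kappa> ` A = A" if "A \<subseteq> topspace X" for A
    using l\<kappa>'[OF that] by (force simp: image_image)
  have lk: "homeomorphic_maps (top_of_set M) X l \<kappa>"
    using \<kappa>l homeomorphic_maps_sym by blast
  have "homotopic_with (\<lambda>f. \<forall>d\<in>\<kappa> ` D. f d = d) (subtopology (top_of_set M) V) (top_of_set M) id v"
    using homV VM by (simp add: subtopology_subtopology Int_absorb1)
  from homotopic_with_homeomorphic_maps[OF lk _ _ this]
  have "homotopic_with (\<lambda>f. \<forall>d\<in>D. f d = d) (subtopology X (l ` V)) X id (l \<circ> v \<circ> \<kappa>)"
    using inv[OF sub(1)] U(1) V(2) VM by auto
  moreover have "openin X (l ` V)"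
    using homeomorphic_map_openness[OF lh, of V] V(1) VM by simp
  moreover have "U \<subseteq> l ` V" using V(2) inv[OF U(2)] by blast
  moreover have "(l \<circ> v \<circ> \<kappa>) ` l ` V \<subseteq> D"
  proof -
    have "\<kappa> ` l ` V = V" using \<kappa>l' VM by (force simp: image_image)
    moreover have "(l \<circ> v \<circ> \<kappa>) ` l ` V = l ` v ` \<kappa> ` l ` V" by (simp add: image_image)
    ultimately have "(l \<circ> v \<circ> \<kappa>) ` l ` V = l ` v ` V" by (simp only:)
    also have "\<dots> \<subseteq> l ` \<kappa> ` D" using V(3) by blast
    finally show ?thesis by (simp add: inv[OF sub(1)])
  qed
  ultimately show thesis using that by blast
qed

section \<open>Comparison of the invariants\<close>

text \<open>The diagonal is a closed copy of \<open>E\<close> in the fibre product, so this is the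
  ANR property of \<open>E\<close> itself.\<close>

lemma diagonal_neighbourhood_retraction:
  fixes E :: "'a topology"
  assumes E: "ANR_space E" and Z: "metrizable_space (fibre_product E p)"
  obtains N r where "openin (fibre_product E p) N" "diagonal E \<subseteq> N"
    "continuous_map (subtopology (fibre_product E p) N) (fibre_product E p) r"
    "r ` N \<subseteq> diagonal E" "\<And>d. d \<in> diagonal E \<Longrightarrow> r d = d"
proof -
  let ?Z = "fibre_product E p" and ?h = "\<lambda>e::'a. (e, e)"
  have im: "?h ` topspace E = diagonal E" by (simp add: diagonal_def)
  have hE: "continuous_map E ?Z ?h"
    unfolding fibre_product_def
    by (auto intro!: continuous_map_into_subtopology continuous_map_pairedI simp: continuous_map_id[unfolded id_def])
  have "homeomorphic_maps E (subtopology ?Z (diagonal E)) ?h fst"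
    unfolding homeomorphic_maps_def
    using hE continuous_map_fibre_product_coordinates(1)[of E p]
    by (auto intro!: continuous_map_into_subtopology continuous_map_from_subtopology simp: diagonal_def)
  then have emb: "embedding_map E ?Z ?h"
    unfolding embedding_map_def im using homeomorphic_map_maps by blast
  have "Hausdorff_space E" using E ANR_space_def metrizable_imp_Hausdorff_space by blast
  then have cl: "closedin ?Z (?h ` topspace E)"
    unfolding im by (rule closedin_diagonal_fibre_product)
  \<comment> \<open>A pair is coded by the weights 1 at \<open>x\<close> and 2 at \<open>y\<close>,
    which add up to 3 when both points agree; the code also remembers the order.\<close>
  have inj: "inj (\<lambda>(x :: 'a, y :: 'a) z. of_bool (z = x) + 2 * of_bool (z = y) :: real)"
  proof (rule injI)
    fix u v :: "'a \<times> 'a"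
    assume eq: "(\<lambda>(x, y) z. of_bool (z = x) + 2 * of_bool (z = y) :: real) u = (\<lambda>(x, y) z. of_bool (z = x) + 2 * of_bool (z = y)) v"
    have "of_bool (z = fst u) + 2 * of_bool (z = snd u) = (of_bool (z = fst v) + 2 * of_bool (z = snd v) :: real)" for z
      using fun_cong[OF eq, of z] by (simp add: case_prod_unfold)
    from this[of "fst u"] this[of "snd u"] show "u = v"
      by (auto simp: prod_eq_iff of_bool_def split: if_splits)
  qed
  obtain N r where N: "openin ?Z N" "?h ` topspace E \<subseteq> N"
    and r: "continuous_map (subtopology ?Z N) E r" "\<And>e. e \<in> topspace E \<Longrightarrow> r (e, e) = e"
    by (rule ANR_space_neighbourhood_retraction[OF E Z emb cl inj]) (rule that)
  show thesis
  proof (rule that)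
    show "openin ?Z N" "diagonal E \<subseteq> N" using N im by auto
    show "continuous_map (subtopology ?Z N) ?Z (\<lambda>z. (r z, r z))"
      by (rule continuous_map_compose'[OF hE r(1)])
    have "N = topspace (subtopology ?Z N)" using openin_subset[OF N(1)] by auto
    then have "r z \<in> topspace E" if "z \<in> N" for z
      using funcset_mem[OF continuous_map_funspace[OF r(1)], of z] that by simp
    then show "(\<lambda>z. (r z, r z)) ` N \<subseteq> diagonal E" by (auto simp: diagonal_def)
    show "(r d, r d) = d" if "d \<in> diagonal E" for d using r(2) that by (auto simp: diagonal_def)
  qed
qed

text \<open>A section becomes a deformation, the deformation extends to an open set because the
  fibre product is an ANR, and the fibration turns it back into a section.\<close>

lemma reserved_section_extend_to_open:
  assumes fib: "hurewicz_fibration E B p" and E: "ANR_space E" and Z: "ANR_space (fibre_product E p)"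
    and U: "diagonal E \<subseteq> U" "U \<subseteq> topspace (fibre_product E p)" and s: "reserved_section E p U s"
  obtains V \<sigma> where "openin (fibre_product E p) V" "U \<subseteq> V" "reserved_section E p V \<sigma>"
proof -
  let ?Z = "fibre_product E p"
  have met: "metrizable_space E" "metrizable_space ?Z" using E Z ANR_space_def by blast+
  have H: "Hausdorff_space E" using met(1) by (rule metrizable_imp_Hausdorff_space)
  obtain N r where N: "openin ?Z N" "diagonal E \<subseteq> N" and r: "continuous_map (subtopology ?Z N) ?Z r"
    "r ` N \<subseteq> diagonal E" "\<And>d. d \<in> diagonal E \<Longrightarrow> r d = d"
    by (rule diagonal_neighbourhood_retraction[OF E met(2)]) (rule that)
  obtain g where g: "g ` U \<subseteq> diagonal E"
    and hom: "homotopic_with (\<lambda>f. \<forall>z\<in>diagonal E. f z = z) (subtopology ?Z U) ?Z id g"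
    by (rule homotopy_of_reserved_section[OF s U])
  obtain V v where V: "openin ?Z V" "U \<subseteq> V" "v ` V \<subseteq> diagonal E"
    and homV: "homotopic_with (\<lambda>f. \<forall>z\<in>diagonal E. f z = z) (subtopology ?Z V) ?Z id v"
    by (rule ANR_space_extend_deformation_to_open[OF Z closedin_diagonal_fibre_product[OF H] N r U hom g])
  have "diagonal E \<subseteq> V" "V \<subseteq> topspace ?Z" using U(1) V openin_subset by blast+
  from reserved_section_of_homotopy[OF fib met(2) H this homV V(3)] show thesis
    using that[OF V(1,2)] by blast
qed

text \<open>With \<open>f i\<close> positive exactly on \<open>U i\<close>, let \<open>F i\<close>
  be the set where \<open>f i\<close> is the largest of the functions. The \<open>U i\<close> cover,
  so the maximum is positive and \<open>F i\<close> lies in \<open>U i\<close>.\<close>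

lemma metrizable_space_closed_shrinking:
  fixes U :: "nat \<Rightarrow> 'a set"
  assumes X: "metrizable_space X" and op: "\<And>i. i \<le> k \<Longrightarrow> openin X (U i)"
    and cov: "(\<Union>i\<le>k. U i) = topspace X"
  obtains F where "\<And>i. i \<le> k \<Longrightarrow> closedin X (F i)" "\<And>i. i \<le> k \<Longrightarrow> F i \<subseteq> U i"
    "(\<Union>i\<le>k. F i) = topspace X"
proof -
  have "\<exists>f. continuous_map X euclideanreal f \<and> (\<forall>x. f x \<in> {0..1}) \<and> (\<forall>x\<in>topspace X. f x = 0 \<longleftrightarrow> x \<notin> U i)"
    if "i \<le> k" for i
    using metrizable_space_zero_set[OF X closedin_diff[OF closedin_topspace op[OF that]]] by (metis Diff_iff)
  then obtain f where f: "\<And>i. i \<le> k \<Longrightarrow> continuous_map X euclideanreal (f i)"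
    and f01: "\<And>i x. i \<le> k \<Longrightarrow> f i x \<in> {0..1}"
    and f0: "\<And>i x. i \<le> k \<Longrightarrow> x \<in> topspace X \<Longrightarrow> f i x = 0 \<longleftrightarrow> x \<notin> U i"
    by metis
  define F where "F i = (\<Inter>j\<le>k. {x \<in> topspace X. f j x - f i x \<in> {..0}})" for i
  show thesis
  proof
    fix i assume i: "i \<le> k"
    show "closedin X (F i)" unfolding F_def
      by (intro closedin_INT closedin_continuous_map_preimage[where Y=euclideanreal] continuous_map_diff f i) auto
    show "F i \<subseteq> U i"
    proof
      fix x assume x: "x \<in> F i"
      then have xX: "x \<in> topspace X" and le: "\<And>j. j \<le> k \<Longrightarrow> f j x \<le> f i x" by (auto simp: F_def)
      obtain j where j: "j \<le> k" "x \<in> U j" using xX cov by blast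
      then have "f j x > 0" using f0[OF j(1) xX] f01[OF j(1), of x] by auto
      then show "x \<in> U i" using le[OF j(1)] f0[OF i xX] by auto
    qed
  next
    have "\<exists>i\<le>k. x \<in> F i" if x: "x \<in> topspace X" for x
    proof -
      have "Max ((\<lambda>i. f i x) ` {..k}) \<in> (\<lambda>i. f i x) ` {..k}" by (intro Max_in) auto
      then obtain i where i: "i \<le> k" "f i x = Max ((\<lambda>i. f i x) ` {..k})" by (metis atMost_iff imageE)
      have "f j x \<le> f i x" if "j \<le> k" for j unfolding i(2) using that by (intro Max_ge) auto
      then show ?thesis using i(1) x by (auto simp: F_def)
    qed
    moreover have "F i \<subseteq> topspace X" if "i \<le> k" for i using that by (auto simp: F_def)
    ultimately show "(\<Union>i\<le>k. F i) = topspace X" by blast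
  qed
qed

text \<open>The section over \<open>F\<close> and the constant paths over the diagonal agree on the
  overlap because the section is reserved. Both pieces are closed, so they paste; this is why open
  covers are shrunk first.\<close>

lemma reserved_section_Un_diagonal:
  assumes E: "Hausdorff_space E" and F: "closedin (fibre_product E p) F" and s: "reserved_section E p F s"
  shows "\<exists>\<sigma>. reserved_section E p (F \<union> diagonal E) \<sigma>"
proof -
  let ?Z = "fibre_product E p" and ?P = "fibrewise_path_space E p"
  let ?X = "subtopology ?Z (F \<union> diagonal E)"
  define \<sigma> where "\<sigma> z = (if z \<in> F then s z else const_path (fst z))" for z
  define c where "c b = (if b then s else (\<lambda>z. const_path (fst z)))" for b
  define T where "T b = (if b then F else diagonal E)" for b
  have sd: "s (e, e) = const_path e" if "e \<in> topspace E" "(e, e) \<in> F" for e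
    using s that by (simp add: reserved_section_def)
  have "continuous_map (prod_topology ?Z unit_interval) E (\<lambda>x. fst (fst x))"
    by (rule continuous_map_compose'[OF continuous_map_fibre_product_coordinates(1) continuous_map_fst])
  from continuous_map_compact_open_curry[OF this]
  have "continuous_map ?Z (compact_open_topology unit_interval E) (\<lambda>z. const_path (fst z))"
    by (simp add: const_path_def)
  then have const: "continuous_map ?Z ?P (\<lambda>z. const_path (fst z))"
    unfolding fibrewise_path_space_def by (intro continuous_map_into_subtopology) (auto simp: const_path_def)
  have "continuous_map ?X ?P \<sigma>"
  proof (rule pasting_lemma_closed[of "UNIV :: bool set" ?X T ?P c])
    fix b
    show "closedin ?X (T b)"
      using F closedin_diagonal_fibre_product[OF E, of p]
      by (auto simp: T_def intro!: closedin_subset_topspace)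
    have "subtopology ?X (T b) = subtopology ?Z (T b)"
      by (auto simp: subtopology_subtopology T_def Int_absorb1)
    moreover have "continuous_map (subtopology ?Z (T b)) ?P (c b)"
      using s const by (auto simp: T_def c_def reserved_section_def continuous_map_from_subtopology)
    ultimately show "continuous_map (subtopology ?X (T b)) ?P (c b)" by simp
  next
    fix b b' z assume "z \<in> topspace ?X \<inter> T b \<inter> T b'"
    then show "c b z = c b' z"
      using sd by (auto simp: T_def c_def diagonal_def split: if_splits)
  next
    fix z assume "z \<in> topspace ?X"
    then show "\<exists>b. b \<in> UNIV \<and> z \<in> T b \<and> \<sigma> z = c b z"
      by (auto simp: T_def c_def \<sigma>_def)
  qed auto
  moreover have "endpoints (\<sigma> z) = z" if "z \<in> F \<union> diagonal E" for z
    using s that by (auto simp: \<sigma>_def reserved_section_def endpoints_def const_path_def diagonal_def)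
  moreover have "\<sigma> (e, e) = const_path e" if "e \<in> topspace E" for e
    using sd that by (simp add: \<sigma>_def)
  ultimately show ?thesis unfolding reserved_section_def by blast
qed

lemma reserved_section_subset:
  "reserved_section E p U s \<Longrightarrow> F \<subseteq> U \<Longrightarrow> reserved_section E p F s"
  unfolding reserved_section_def using continuous_map_from_subtopology_mono by blast

lemma Inf_enat_antimono:
  assumes "\<And>k. P k \<Longrightarrow> Q k"
  shows "Inf {enat k | k. Q k} \<le> Inf {enat k | k. P k}"
  using assms by (intro Inf_superset_mono) blast

theorem theorem3p24:
  fixes E :: "'a topology" and B :: "'b topology" and p :: "'a \<Rightarrow> 'b"
  assumes "hurewicz_fibration E B p"
    and "ANR_space E"
    and "ANR_space (fibre_product E p)"
  shows "TC_M E p = TC_gM E p \<and> TC_gM E p = TC_DM E p"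
proof -
  let ?Z = "fibre_product E p"
  have met: "metrizable_space E" "metrizable_space ?Z" using assms(2,3) ANR_space_def by blast+
  have H: "Hausdorff_space E" using met(1) by (rule metrizable_imp_Hausdorff_space)
  \<comment> \<open>The three inequalities form a cycle. This one only forgets that the open sets
    contain the diagonal; the next enlarges arbitrary sets to open ones.\<close>
  have "TC_DM E p \<le> TC_M E p"
    unfolding TC_DM_def TC_M_def by (rule Inf_enat_antimono) meson
  moreover have "TC_M E p \<le> TC_gM E p"
    unfolding TC_M_def TC_gM_def
  proof (rule Inf_enat_antimono, elim exE conjE)
    fix k and U :: "nat \<Rightarrow> ('a \<times> 'a) set"
    assume cov: "(\<Union>i\<le>k. U i) = topspace ?Z"
      and U: "\<forall>i\<le>k. diagonal E \<subseteq> U i \<and> (\<exists>\<sigma>. reserved_section E p (U i) \<sigma>)"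
    have "\<exists>V. openin ?Z V \<and> U i \<subseteq> V \<and> (\<exists>\<sigma>. reserved_section E p V \<sigma>)" if i: "i \<le> k" for i
    proof -
      have "U i \<subseteq> topspace ?Z" using i cov by blast
      then show ?thesis using U i reserved_section_extend_to_open[OF assms, of "U i"] by metis
    qed
    then obtain V where V: "\<And>i. i \<le> k \<Longrightarrow> openin ?Z (V i) \<and> U i \<subseteq> V i \<and> (\<exists>\<sigma>. reserved_section E p (V i) \<sigma>)"
      by metis
    have "(\<Union>i\<le>k. V i) = topspace ?Z"
    proof
      show "(\<Union>i\<le>k. V i) \<subseteq> topspace ?Z" using V openin_subset by blast
      show "topspace ?Z \<subseteq> (\<Union>i\<le>k. V i)" unfolding cov[symmetric] using V by blast
    qed
    moreover have "\<forall>i\<le>k. openin ?Z (V i) \<and> diagonal E \<subseteq> V i \<and> (\<exists>\<sigma>. reserved_section E p (V i) \<sigma>)"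
      using U V by blast
    ultimately show "\<exists>U. (\<Union>i\<le>k. U i) = topspace ?Z \<and>
        (\<forall>i\<le>k. openin ?Z (U i) \<and> diagonal E \<subseteq> U i \<and> (\<exists>\<sigma>. reserved_section E p (U i) \<sigma>))"
      by (intro exI[of _ V] conjI)
  qed
  \<comment> \<open>Shrinking to closed sets and adjoining the diagonal gives up openness, which
    \<open>TC_gM\<close> does not ask for, and gains the whole diagonal.\<close>
  moreover have "TC_gM E p \<le> TC_DM E p"
    unfolding TC_gM_def TC_DM_def
  proof (rule Inf_enat_antimono, elim exE conjE)
    fix k and U :: "nat \<Rightarrow> ('a \<times> 'a) set"
    assume cov: "(\<Union>i\<le>k. U i) = topspace ?Z"
      and U: "\<forall>i\<le>k. openin ?Z (U i) \<and> (\<exists>\<sigma>. reserved_section E p (U i) \<sigma>)"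
    obtain F where F: "\<And>i. i \<le> k \<Longrightarrow> closedin ?Z (F i)" "\<And>i. i \<le> k \<Longrightarrow> F i \<subseteq> U i"
      and covF: "(\<Union>i\<le>k. F i) = topspace ?Z"
      using metrizable_space_closed_shrinking[OF met(2) _ cov] U by metis
    have "(\<Union>i\<le>k. F i \<union> diagonal E) = topspace ?Z"
      using covF diagonal_subset_fibre_product[of E p] by blast
    moreover have "\<exists>\<sigma>. reserved_section E p (F i \<union> diagonal E) \<sigma>" if i: "i \<le> k" for i
      using U i reserved_section_Un_diagonal[OF H F(1)[OF i]] reserved_section_subset[OF _ F(2)[OF i]]
      by blast
    ultimately show "\<exists>U. (\<Union>i\<le>k. U i) = topspace ?Z \<and>
        (\<forall>i\<le>k. diagonal E \<subseteq> U i \<and> (\<exists>\<sigma>. reserved_section E p (U i) \<sigma>))"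
      by (intro conjI exI[of _ "\<lambda>i. F i \<union> diagonal E"]) auto
  qed
  ultimately show ?thesis by (meson antisym order_trans)
qed

end
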